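(* Suppose $P_1,P_2,P_3,P_4$ are pairwise disjoint and non-parallel planes in $\mathbb{H}^3$ such that for each $i$, a single half-space $H_i$ bounded by $P_i$ contains $P_j$ for all $j\ne i$, and let $\Delta$ be the truncated tetrahedron determined by the $P_i$. For any fixed $i<j\in\{1,2,3,4\}$ and $k<l\in\{1,2,3,4\}-\{i,j\}$, let $T(x,y;a,b,c,d)$ be the length of the transversal of $\Delta$ joining the internal edge $\lambda_{ij}$ to its opposite $\lambda_{kl}$, where $x=\cosh\ell(\lambda_{ij})$, $y=\cosh\ell(\lambda_{kl})$, and $a,b,c,d$ are the hyperbolic cosines of the other four internal edge lengths of $\Delta$. For some fixed $L>1$, if each of $a$, $b$, $c$, and $d$ is at least $L$, then \[ \cosh T(x,y;a,b,c,d)\ \ge\ \frac{2L}{\sqrt{(x-1)(y-1)}}, \] with equality if and only if $a=b=c=d=L$.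
   Context: A plane in $\mathbb{H}^3$ is a two-dimensional totally geodesic copy of $\mathbb{H}^2$. A half-space is the closure of one component of the complement of a plane (its boundary plane). Two disjoint planes are parallel if their ideal boundaries intersect; so pairwise disjoint and non-parallel planes are at positive distance, attained along a unique common perpendicular arc. Truncated tetrahedron. Let $P_1,\dots,P_4$ and $H_1,\dots,H_4$ be as in the claim. For each $i$ there is a unique plane $\widehat P_i$ that meets $P_j$ at right angles for every $j\ne i$. If $\widehat P_i$ does not meet $P_i$ orthogonally for some (hence every) $i$, then for each $i$ there is a single half-space $\widehat H_i$ bounded by $\widehat P_i$ containing the shortest geodesic arc from $P_j$ to $P_i$ for all $j\neq i$, and the truncated tetrahedron determined by the $P_i$ is $\Delta=\left(\bigcap_{i=1}^4 H_i\right)\cap\left(\bigcap_{i=1}^4\widehat H_i\right)$. Otherwise all $\widehat P_i$ equal a single plane $\widehat P$ orthogonal to every $P_i$; then, after renumbering so that the perpendicular geodesic to $P_1$ and $P_3$ separates $P_2\cap\widehat P$ from $P_4\cap\widehat P$, the (degenerate) truncated tetrahedron is $\Delta=\widehat P\cap\left(\bigcap_{i=1}^4 H_i\right)\cap h_{12}\cap h_{23}\cap h_{34}\cap h_{14}$, where $h_{12}$ is the half-plane of $\widehat P$ bounded by the perpendicular geodesic to $P_1$ and $P_2$ that contains $P_3\cap\widehat P$ and $P_4\cap\widehat P$, and $h_{23},h_{34},h_{14}$ are defined analogously. For $i<j$ the internal edge $\lambda_{ij}$ is the shortest arc in $\mathbb{H}^3$ joining $P_i$ to $P_j$, and $\ell(\lambda_{ij})$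 is its length. The internal edge opposite $\lambda_{ij}$ is $\lambda_{kl}$ where $\{k,l\}=\{1,2,3,4\}-\{i,j\}$. The transversal of $\Delta$ joining $\lambda_{ij}$ to its opposite $\lambda_{kl}$ is the shortest geodesic arc with one endpoint on each of the two edges, or, if these edges intersect, their point of intersection (so its length is $0$). The order of the last four variables is: $a,b,c,d$ are the hyperbolic cosines of the distances between $P_i$ and $P_k$, $P_i$ and $P_l$, $P_j$ and $P_k$, $P_j$ and $P_l$, respectively. The transversal length depends only on $(x,y;a,b,c,d)$, so $T$ is a well-defined function on tuples realized by such configurations. *)

theory Defs
  imports "HOL-Analysis.Analysis"
begin

section \<open>Hyperbolic space\<close>

text \<open>Vectors of Minkowski space are pairs of a time and a space component. Hyperbolic space is
  the upper sheet of the hyperboloid, with the distance given by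
  \<open>cosh (dist p q) = - mink p q\<close> (curvature \<open>-1\<close>).\<close>

definition mink :: "real \<times> 'a::real_inner \<Rightarrow> real \<times> 'a \<Rightarrow> real" where
  "mink u v = inner (snd u) (snd v) - fst u * fst v"

lemma mink_commute: "mink u v = mink v u"
  by (simp add: mink_def inner_commute mult.commute)

lemma mink_simps:
  "mink (u + v) w = mink u w + mink v w"
  "mink (u - v) w = mink u w - mink v w"
  "mink (c *\<^sub>R u) w = c * mink u w"
  "mink w (u + v) = mink w u + mink w v"
  "mink w (u - v) = mink w u - mink w v"
  "mink w (c *\<^sub>R u) = c * mink w u"
  by (simp_all add: mink_def inner_simps algebra_simps)

typedef (overloaded) 'a hyp = "{p :: real \<times> 'a::real_inner. mink p p = -1 \<and> fst p > 0}"
  by (rule exI[of _ "(1, 0)"]) (simp add: mink_def)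

type_synonym hyp2 = "(real^2) hyp"
type_synonym hyp3 = "(real^3) hyp"

lemma mink_Rep_self [simp]: "mink (Rep_hyp p) (Rep_hyp p) = -1"
  and fst_Rep_pos [simp]: "fst (Rep_hyp p) > 0"
  using Rep_hyp[of p] by auto

lemma mink_orth_Rep:
  assumes "mink v (Rep_hyp p) = 0"
  shows "mink v v \<ge> 0" and "mink v v = 0 \<Longrightarrow> v = 0"
proof -
  define t x where "t = fst (Rep_hyp p)" and "x = snd (Rep_hyp p)"
  have t: "t > 0" "inner x x = t^2 - 1"
    using mink_Rep_self[of p] fst_Rep_pos[of p]
    by (simp_all add: t_def x_def mink_def power2_eq_square)
  have "inner (snd v) x = fst v * t"
    using assms by (simp add: mink_def t_def x_def)
  then have "(fst v * t)^2 \<le> inner (snd v) (snd v) * inner x x"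
    using Cauchy_Schwarz_ineq[of "snd v" x] by simp
  then have 1: "t^2 * (fst v)^2 \<le> t^2 * inner (snd v) (snd v) - inner (snd v) (snd v)"
    using t(2) by (simp add: power_mult_distrib algebra_simps)
  have nn: "inner (snd v) (snd v) \<ge> 0" by simp
  from 1 nn have "t^2 * (fst v)^2 \<le> t^2 * inner (snd v) (snd v)" by linarith
  then show "mink v v \<ge> 0"
    using t(1) by (simp add: mink_def power2_eq_square)
  assume "mink v v = 0"
  then have 2: "inner (snd v) (snd v) = (fst v)^2"
    by (simp add: mink_def power2_eq_square)
  with 1 nn have "inner (snd v) (snd v) = 0" by simp
  with 2 show "v = 0" by (simp add: prod_eq_iff)
qed

lemma mink_Rep_proj:
  fixes p q :: "'a::real_inner hyp"
  defines "v \<equiv> Rep_hyp p + mink (Rep_hyp p) (Rep_hyp q) *\<^sub>R Rep_hyp q"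
  shows "mink v (Rep_hyp q) = 0" and "mink v v = (mink (Rep_hyp p) (Rep_hyp q))^2 - 1"
  unfolding v_def
  by (simp_all add: mink_simps mink_commute[of "Rep_hyp q"] power2_eq_square algebra_simps)

lemma mink_Rep_le: "- mink (Rep_hyp p) (Rep_hyp q) \<ge> 1"
proof -
  have "(mink (Rep_hyp p) (Rep_hyp q))^2 \<ge> 1"
    using mink_orth_Rep(1)[OF mink_Rep_proj(1)[of p q]] mink_Rep_proj(2)[of p q] by simp
  then have ge1: "\<bar>mink (Rep_hyp p) (Rep_hyp q)\<bar> \<ge> 1"
    using abs_le_square_iff[of 1 "mink (Rep_hyp p) (Rep_hyp q)"] by simp
  have n: "norm (snd (Rep_hyp r)) < fst (Rep_hyp r)" for r :: "'a hyp"
  proof -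
    have "(norm (snd (Rep_hyp r)))^2 < (fst (Rep_hyp r))^2"
      using mink_Rep_self[of r, unfolded mink_def]
      unfolding power2_norm_eq_inner power2_eq_square[of "fst (Rep_hyp r)"] by linarith
    then show ?thesis using fst_Rep_pos[of r] by (simp add: power2_less_imp_less less_imp_le)
  qed
  have "inner (snd (Rep_hyp p)) (snd (Rep_hyp q)) \<le> norm (snd (Rep_hyp p)) * norm (snd (Rep_hyp q))"
    by (rule norm_cauchy_schwarz)
  also have "\<dots> \<le> fst (Rep_hyp p) * fst (Rep_hyp q)"
    using n[of p] n[of q] by (intro mult_mono) (auto intro: less_imp_le)
  finally have "mink (Rep_hyp p) (Rep_hyp q) \<le> 0" by (simp add: mink_def)
  with ge1 show ?thesis by linarith
qed

lemma mink_orth_Cauchy_Schwarz: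
  assumes "mink u (Rep_hyp p) = 0" "mink v (Rep_hyp p) = 0"
  shows "- mink u v \<le> sqrt (mink u u) * sqrt (mink v v)"
proof (cases "mink u u = 0 \<or> mink v v = 0")
  case True
  then have "u = 0 \<or> v = 0" using mink_orth_Rep(2) assms by blast
  then show ?thesis by (auto simp: mink_def)
next
  case False
  define a b where "a = sqrt (mink u u)" and "b = sqrt (mink v v)"
  have ab: "a > 0" "b > 0" "mink u u = a^2" "mink v v = b^2"
    using False mink_orth_Rep(1)[OF assms(1)] mink_orth_Rep(1)[OF assms(2)]
    by (auto simp: a_def b_def)
  have "mink (b *\<^sub>R u + a *\<^sub>R v) (Rep_hyp p) = 0"
    using assms by (simp add: mink_simps)
  from mink_orth_Rep(1)[OF this]
  have "2 * (a * b) * (a * b + mink u v) \<ge> 0"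
    by (simp add: mink_simps ab mink_commute[of v u] power2_eq_square algebra_simps)
  moreover have "2 * (a * b) > 0" using ab by simp
  ultimately have "a * b + mink u v \<ge> 0" by (simp only: zero_le_mult_iff) auto
  then show ?thesis by (simp add: a_def b_def)
qed

instantiation hyp :: (real_inner) metric_space
begin

definition dist_hyp :: "'a hyp \<Rightarrow> 'a hyp \<Rightarrow> real" where
  "dist_hyp p q = arcosh (- mink (Rep_hyp p) (Rep_hyp q))"

definition uniformity_hyp :: "('a hyp \<times> 'a hyp) filter" where
  "uniformity_hyp = (INF e\<in>{0<..}. principal {(x, y). dist x y < e})"

definition open_hyp :: "'a hyp set \<Rightarrow> bool" where
  "open_hyp U \<longleftrightarrow> (\<forall>x\<in>U. eventually (\<lambda>(x', y). x' = x \<longrightarrow> y \<in> U) uniformity)"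

instance
proof
  fix x y z :: "'a hyp"
  show "dist x y = 0 \<longleftrightarrow> x = y"
  proof
    assume "dist x y = 0"
    then have m: "mink (Rep_hyp x) (Rep_hyp y) = -1"
      using mink_Rep_le[of x y] by (simp add: dist_hyp_def)
    then have "Rep_hyp x + mink (Rep_hyp x) (Rep_hyp y) *\<^sub>R Rep_hyp y = 0"
      using mink_orth_Rep(2)[OF mink_Rep_proj(1)[of x y]] mink_Rep_proj(2)[of x y] by simp
    with m show "x = y" by (simp add: Rep_hyp_inject)
  qed (simp add: dist_hyp_def)
  let ?A = "- mink (Rep_hyp x) (Rep_hyp z)" and ?B = "- mink (Rep_hyp y) (Rep_hyp z)"
  let ?u = "Rep_hyp x + mink (Rep_hyp x) (Rep_hyp z) *\<^sub>R Rep_hyp z"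
  let ?v = "Rep_hyp y + mink (Rep_hyp y) (Rep_hyp z) *\<^sub>R Rep_hyp z"
  have "- mink ?u ?v \<le> sqrt (mink ?u ?u) * sqrt (mink ?v ?v)"
    by (rule mink_orth_Cauchy_Schwarz[OF mink_Rep_proj(1) mink_Rep_proj(1)])
  moreover have "mink ?u ?v = mink (Rep_hyp x) (Rep_hyp y) + ?A * ?B"
    by (simp add: mink_simps mink_commute[of "Rep_hyp z"] algebra_simps)
  ultimately have "- mink (Rep_hyp x) (Rep_hyp y)
      \<le> ?A * ?B + sqrt (?A^2 - 1) * sqrt (?B^2 - 1)"
    by (simp add: mink_Rep_proj(2))
  also have "\<dots> = cosh (dist x z + dist y z)"
    using mink_Rep_le[of x z] mink_Rep_le[of y z]
    by (simp add: cosh_add sinh_arcosh_real dist_hyp_def)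
  finally have "cosh (dist x y) \<le> cosh (dist x z + dist y z)"
    using mink_Rep_le[of x y] by (simp add: dist_hyp_def)
  moreover have "0 \<le> dist p q" for p q :: "'a hyp"
    using mink_Rep_le[of p q] by (simp add: dist_hyp_def)
  ultimately show "dist x y \<le> dist x z + dist y z"
    by (simp add: cosh_real_nonneg_le_iff)
qed (simp_all only: uniformity_hyp_def open_hyp_def)

end

section \<open>Geodesics, planes and half-spaces\<close>

definition isometry_on :: "'a::metric_space set \<Rightarrow> ('a \<Rightarrow> 'b::metric_space) \<Rightarrow> bool" where
  "isometry_on S f \<longleftrightarrow> (\<forall>x\<in>S. \<forall>y\<in>S. dist (f x) (f y) = dist x y)"

definition geodesic_line :: "'a::metric_space set \<Rightarrow> bool" where
  "geodesic_line g \<longleftrightarrow> (\<exists>f :: real \<Rightarrow> 'a. isometry_on UNIV f \<and> g = range f)"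

text \<open>The degenerate arc \<open>{p}\<close> from \<open>p\<close> to \<open>p\<close> is allowed.\<close>

definition geodesic_arc :: "'a::metric_space \<Rightarrow> 'a \<Rightarrow> 'a set \<Rightarrow> bool" where
  "geodesic_arc p q \<gamma> \<longleftrightarrow>
     (\<exists>f :: real \<Rightarrow> 'a. isometry_on {0..dist p q} f \<and> f 0 = p \<and> f (dist p q) = q
        \<and> \<gamma> = f ` {0..dist p q})"

definition arc_length :: "'a::metric_space set \<Rightarrow> real" where
  "arc_length \<gamma> = (THE r. \<exists>p q. geodesic_arc p q \<gamma> \<and> r = dist p q)"

definition is_shortest_arc :: "'a::metric_space set \<Rightarrow> 'a set \<Rightarrow> 'a set \<Rightarrow> bool" where
  "is_shortest_arc A B \<gamma> \<longleftrightarrow>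
     (\<exists>p\<in>A. \<exists>q\<in>B. geodesic_arc p q \<gamma>) \<and>
     (\<forall>p\<in>A. \<forall>q\<in>B. \<forall>\<gamma>'. geodesic_arc p q \<gamma>' \<longrightarrow> arc_length \<gamma> \<le> arc_length \<gamma>')"

definition shortest_arc :: "'a::metric_space set \<Rightarrow> 'a set \<Rightarrow> 'a set" where
  "shortest_arc A B = (SOME \<gamma>. is_shortest_arc A B \<gamma>)"

text \<open>An isometric copy of the hyperbolic plane is automatically totally geodesic.\<close>

definition plane :: "hyp3 set \<Rightarrow> bool" where
  "plane P \<longleftrightarrow> (\<exists>f :: hyp2 \<Rightarrow> hyp3. isometry_on UNIV f \<and> P = range f)"

definition half_space :: "hyp3 set \<Rightarrow> hyp3 set \<Rightarrow> bool" where
  "half_space P K \<longleftrightarrow> plane P \<and> (\<exists>C \<in> components (- P). K = closure C)"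

text \<open>Ideal points are classes of asymptotic geodesic rays (values of a ray at negative times are
  irrelevant); the ideal boundary of a plane consists of the classes of the rays inside it.\<close>

definition geodesic_ray :: "(real \<Rightarrow> 'a::metric_space) \<Rightarrow> bool" where
  "geodesic_ray r \<longleftrightarrow> isometry_on {0..} r"

definition asymptotic_class :: "(real \<Rightarrow> 'a::metric_space) \<Rightarrow> (real \<Rightarrow> 'a) set" where
  "asymptotic_class r = {s. geodesic_ray s \<and> bounded ((\<lambda>t. dist (r t) (s t)) ` {0..})}"

definition ideal_boundary :: "'a::metric_space set \<Rightarrow> (real \<Rightarrow> 'a) set set" where
  "ideal_boundary S = {asymptotic_class r | r. geodesic_ray r \<and> r ` {0..} \<subseteq> S}"

definition parallel_planes :: "hyp3 set \<Rightarrow> hyp3 set \<Rightarrow> bool" where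
  "parallel_planes P Q \<longleftrightarrow> P \<inter> Q = {} \<and> ideal_boundary P \<inter> ideal_boundary Q \<noteq> {}"

definition unit_normal :: "real \<times> (real^3) \<Rightarrow> hyp3 set \<Rightarrow> bool" where
  "unit_normal v P \<longleftrightarrow> mink v v = 1 \<and> (\<forall>p\<in>P. mink v (Rep_hyp p) = 0)"

text \<open>Orthogonality of the normals forces the planes to intersect.\<close>

definition orthogonal_planes :: "hyp3 set \<Rightarrow> hyp3 set \<Rightarrow> bool" where
  "orthogonal_planes P Q \<longleftrightarrow>
     plane P \<and> plane Q \<and> (\<exists>v w. unit_normal v P \<and> unit_normal w Q \<and> mink v w = 0)"

section \<open>Truncated tetrahedra\<close>

definition internal_edge :: "(nat \<Rightarrow> hyp3 set) \<Rightarrow> nat \<Rightarrow> nat \<Rightarrow> hyp3 set" where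
  "internal_edge P i j = shortest_arc (P i) (P j)"

definition opposite_plane :: "(nat \<Rightarrow> hyp3 set) \<Rightarrow> nat \<Rightarrow> hyp3 set" where
  "opposite_plane P i = (THE Q. plane Q \<and> (\<forall>j\<in>{1..4} - {i}. orthogonal_planes Q (P j)))"

definition opposite_half_space :: "(nat \<Rightarrow> hyp3 set) \<Rightarrow> nat \<Rightarrow> hyp3 set" where
  "opposite_half_space P i =
     (THE K. half_space (opposite_plane P i) K \<and> (\<forall>j\<in>{1..4} - {i}. internal_edge P j i \<subseteq> K))"

definition degenerate :: "(nat \<Rightarrow> hyp3 set) \<Rightarrow> bool" where
  "degenerate P \<longleftrightarrow> (\<forall>i\<in>{1..4}. orthogonal_planes (opposite_plane P i) (P i))"

definition perp_geodesic :: "(nat \<Rightarrow> hyp3 set) \<Rightarrow> nat \<Rightarrow> nat \<Rightarrow> hyp3 set" where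
  "perp_geodesic P i j = (THE g. geodesic_line g \<and> internal_edge P i j \<subseteq> g)"

text \<open>In the next three definitions \<open>Q\<close> is the common orthogonal plane of a degenerate
  configuration. The set \<open>opposite_half_plane Q P i j k l\<close> is the half-plane of \<open>Q\<close> bounded by
  the perpendicular geodesic to \<open>P i\<close> and \<open>P j\<close> on the side of \<open>P k\<close> and \<open>P l\<close>.\<close>

definition opposite_half_plane ::
    "hyp3 set \<Rightarrow> (nat \<Rightarrow> hyp3 set) \<Rightarrow> nat \<Rightarrow> nat \<Rightarrow> nat \<Rightarrow> nat \<Rightarrow> hyp3 set" where
  "opposite_half_plane Q P i j k l =
     (THE K. (\<exists>C \<in> components (Q - perp_geodesic P i j). K = closure C)
        \<and> P k \<inter> Q \<subseteq> K \<and> P l \<inter> Q \<subseteq> K)"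

definition cyclically_ordered :: "hyp3 set \<Rightarrow> (nat \<Rightarrow> hyp3 set) \<Rightarrow> bool" where
  "cyclically_ordered Q P \<longleftrightarrow>
     (\<exists>C \<in> components (Q - perp_geodesic P 1 3). \<exists>D \<in> components (Q - perp_geodesic P 1 3).
        C \<noteq> D \<and> P 2 \<inter> Q \<subseteq> C \<and> P 4 \<inter> Q \<subseteq> D)"

definition planar_tetrahedron ::
    "hyp3 set \<Rightarrow> (nat \<Rightarrow> hyp3 set) \<Rightarrow> (nat \<Rightarrow> hyp3 set) \<Rightarrow> hyp3 set" where
  "planar_tetrahedron Q P H =
     Q \<inter> (\<Inter>i\<in>{1..4}. H i)
     \<inter> opposite_half_plane Q P 1 2 3 4 \<inter> opposite_half_plane Q P 2 3 1 4
     \<inter> opposite_half_plane Q P 3 4 1 2 \<inter> opposite_half_plane Q P 1 4 2 3"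

definition truncated_tetrahedron ::
    "(nat \<Rightarrow> hyp3 set) \<Rightarrow> (nat \<Rightarrow> hyp3 set) \<Rightarrow> hyp3 set" where
  "truncated_tetrahedron P H =
     (if degenerate P then
        let Q = opposite_plane P 1;
            \<sigma> = (SOME \<sigma>. bij_betw \<sigma> {1..4::nat} {1..4} \<and> cyclically_ordered Q (P \<circ> \<sigma>))
        in planar_tetrahedron Q (P \<circ> \<sigma>) (H \<circ> \<sigma>)
      else (\<Inter>i\<in>{1..4}. H i) \<inter> (\<Inter>i\<in>{1..4}. opposite_half_space P i))"

definition transversal :: "(nat \<Rightarrow> hyp3 set) \<Rightarrow> nat \<Rightarrow> nat \<Rightarrow> nat \<Rightarrow> nat \<Rightarrow> hyp3 set" where
  "transversal P i j k l =
     (let e = internal_edge P i j; e' = internal_edge P k l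
      in if e \<inter> e' \<noteq> {} then e \<inter> e' else shortest_arc e e')"

end

theory Submission
  imports Defs
begin

text \<open>In the hyperboloid model each plane is the orthogonal complement of a unit spacelike vector.
  Choose the normals \<open>v\<^sub>m\<close> pointing out of the half-spaces; then \<open>- mink v\<^sub>m v\<^sub>n > 1\<close> is the
  hyperbolic cosine of the distance between the planes, and the points of the common perpendicular
  are the nonnegative combinations \<open>\<alpha> v\<^sub>m + \<beta> v\<^sub>n\<close> of norm \<open>-1\<close>. For points
  \<open>\<alpha> v\<^sub>i + \<beta> v\<^sub>j\<close> and \<open>\<gamma> v\<^sub>k + \<delta> v\<^sub>l\<close> of two opposite edges, the hyperbolic cosine of their distance is
  \<open>\<alpha>\<gamma>a + \<alpha>\<delta>b + \<beta>\<gamma>c + \<beta>\<delta>d \<ge> L (\<alpha> + \<beta>) (\<gamma> + \<delta>)\<close>, and the norm condition gives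
  \<open>(\<alpha> + \<beta>)\<^sup>2 \<ge> 2 / (x - 1)\<close> with equality exactly at the midpoint of the edge. Thus only the
  minimality of the transversal is needed, not a formula for its length.\<close>

section \<open>The hyperboloid model\<close>

lemma mink_uminus [simp]: "mink (- u) v = - mink u v" "mink u (- v) = - mink u v"
  by (simp_all add: mink_def)

lemma mink_zero [simp]: "mink 0 v = 0" "mink v 0 = 0"
  by (simp_all add: mink_def)

lemma mink_sum: "mink (sum f S) w = (\<Sum>s\<in>S. mink (f s) w)"
  by (induction S rule: infinite_finite_induct) (simp_all add: mink_simps)

lemma mink_Rep_Rep: "mink (Rep_hyp p) (Rep_hyp q) = - cosh (dist p q)"
  using mink_Rep_le[of p q] by (simp add: dist_hyp_def)

lemma mink_Rep_eq_iff: "mink (Rep_hyp p) (Rep_hyp q) = -1 \<longleftrightarrow> p = q"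
proof
  assume "mink (Rep_hyp p) (Rep_hyp q) = -1"
  then have "dist p q = 0" by (simp add: dist_hyp_def)
  then show "p = q" by simp
qed simp

lemma norm_snd_Rep: "norm (snd (Rep_hyp p)) < fst (Rep_hyp p)"
proof -
  have "(norm (snd (Rep_hyp p)))\<^sup>2 < (fst (Rep_hyp p))\<^sup>2"
    using mink_Rep_self[of p, unfolded mink_def]
    unfolding power2_norm_eq_inner power2_eq_square[of "fst (Rep_hyp p)"] by linarith
  then show ?thesis using fst_Rep_pos[of p] by (simp add: power2_less_imp_less less_imp_le)
qed

lemma ex_Rep_hyp:
  assumes "mink w w = -1" "fst w > 0"
  obtains p where "Rep_hyp p = w"
  using assms Abs_hyp_inverse[of w] by blast

lemma ex_Rep_hyp_uminus:
  assumes "mink w w = -1"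
  obtains p where "Rep_hyp p = w" | p where "Rep_hyp p = - w"
proof -
  have "fst w \<noteq> 0"
  proof
    assume "fst w = 0"
    then have "mink w w = inner (snd w) (snd w)" by (simp add: mink_def)
    with assms show False using inner_ge_zero[of "snd w"] by linarith
  qed
  then consider "fst w > 0" | "fst (- w) > 0" by fastforce
  then show ?thesis
    using ex_Rep_hyp[of w] ex_Rep_hyp[of "- w"] assms that by cases auto
qed

lemma timelike_scale_Rep:
  assumes "mink w w < 0"
  obtains p c where "Rep_hyp p = c *\<^sub>R w"
proof -
  let ?c = "1 / sqrt (- mink w w)"
  have "mink (?c *\<^sub>R w) (?c *\<^sub>R w) = -1"
    using assms by (simp add: mink_simps flip: power2_eq_square add: divide_simps)
  then show ?thesis
    using ex_Rep_hyp_uminus that[of _ ?c] that[of _ "- ?c"] by (metis scaleR_minus_left)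
qed

text \<open>Cauchy-Schwarz on the space parts: \<open>snd n\<close> has norm exactly
  \<open>fst n\<close>, while a point of the sheet has space norm strictly below its time component.
  The sign is what orients rays towards the ideal point \<open>n\<close>.\<close>

lemma null_future_mink_neg:
  assumes "mink n n = 0" "fst n > 0"
  shows "mink n (Rep_hyp p) < 0"
proof -
  have n: "norm (snd n) = fst n"
    using assms by (simp add: mink_def norm_eq_sqrt_inner)
  have "inner (snd n) (snd (Rep_hyp p)) \<le> fst n * norm (snd (Rep_hyp p))"
    using norm_cauchy_schwarz[of "snd n" "snd (Rep_hyp p)"] n by simp
  also have "\<dots> < fst n * fst (Rep_hyp p)"
    using norm_snd_Rep[of p] assms(2) by simp
  finally show ?thesis by (simp add: mink_def)
qed

lemma isometry_on_mink:
  assumes "isometry_on S f" "p \<in> S" "q \<in> S"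
  shows "mink (Rep_hyp (f p)) (Rep_hyp (f q)) = mink (Rep_hyp p) (Rep_hyp q)"
  using assms by (simp add: isometry_on_def mink_Rep_Rep)

text \<open>Every vector is a combination of two points of the hyperboloid, so \<open>mink v\<close> restricts to a
  combination of functions \<open>cosh \<circ> dist q\<close>.\<close>

lemma continuous_on_mink_Rep: "continuous_on S (\<lambda>p. mink v (Rep_hyp p))"
proof -
  let ?s = "sqrt (1 + inner (snd v) (snd v))"
  have pos: "1 + inner (snd v) (snd v) > 0"
    using inner_ge_zero[of "snd v"] by linarith
  obtain o' :: "'a hyp" where o': "Rep_hyp o' = (1, 0)"
    by (rule ex_Rep_hyp[of "(1, 0)"]) (simp_all add: mink_def)
  obtain q where q: "Rep_hyp q = (?s, snd v)"
    by (rule ex_Rep_hyp[of "(?s, snd v)"]) (use pos in \<open>simp_all add: mink_def flip: power2_eq_square\<close>)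
  have v: "v = Rep_hyp q + (fst v - ?s) *\<^sub>R Rep_hyp o'"
    by (simp add: o' q prod_eq_iff)
  have "mink v (Rep_hyp p) = - cosh (dist q p) - (fst v - ?s) * cosh (dist o' p)" for p
    by (subst v) (simp add: mink_simps mink_Rep_Rep)
  then show ?thesis by (simp add: continuous_intros)
qed

section \<open>Planes as orthogonal complements\<close>

text \<open>For \<open>mink v v = 1\<close> this is the totally geodesic hypersurface with unit
  normal \<open>v\<close>. Writing planes in this form turns incidence and distance into linear
  algebra.\<close>

definition wall :: "real \<times> 'a::real_inner \<Rightarrow> 'a hyp set" where
  "wall v = {p. mink v (Rep_hyp p) = 0}"

lemma mem_wall: "p \<in> wall v \<longleftrightarrow> mink v (Rep_hyp p) = 0"
  by (simp add: wall_def)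

lemma wall_uminus: "wall (- v) = wall v"
  by (simp add: wall_def)

text \<open>Projecting the time vector \<open>(1, 0)\<close> off \<open>v\<close> only decreases its
  square, so the projection stays timelike and can be scaled onto the sheet.\<close>

lemma wall_nonempty:
  assumes "mink v v = 1"
  shows "wall v \<noteq> {}"
proof -
  let ?e = "(1, 0) :: real \<times> 'a"
  define w where "w = ?e - mink v ?e *\<^sub>R v"
  have "mink w w = mink ?e ?e - (mink v ?e)\<^sup>2"
    by (simp add: w_def mink_simps assms mink_commute[of ?e v] power2_eq_square)
  also have "\<dots> \<le> -1" by (simp add: mink_def)
  finally have "mink w w < 0" by simp
  then obtain p c where "Rep_hyp p = c *\<^sub>R w" by (rule timelike_scale_Rep)
  then have "p \<in> wall v" by (simp add: mem_wall w_def mink_simps assms)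
  then show ?thesis by blast
qed

section \<open>Minkowski orthogonal systems and normals of planes\<close>

text \<open>Pairing a vanishing combination with one member leaves its coefficient times a nonzero
  square; nonzero squares take the place of positive definiteness.\<close>

lemma independent_mink_orthogonal:
  fixes S :: "(real \<times> 'a::real_inner) set"
  assumes "finite S" "\<And>u v. u \<in> S \<Longrightarrow> v \<in> S \<Longrightarrow> u \<noteq> v \<Longrightarrow> mink u v = 0"
    and "\<And>u. u \<in> S \<Longrightarrow> mink u u \<noteq> 0"
  shows "independent S"
proof -
  have "c v = 0" if "(\<Sum>u\<in>S. c u *\<^sub>R u) = 0" "v \<in> S" for c v
  proof -
    have "0 = mink (\<Sum>u\<in>S. c u *\<^sub>R u) v" using that by simp
    also have "\<dots> = (\<Sum>u\<in>S. c u * mink u v)" by (simp add: mink_sum mink_simps)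
    also have "\<dots> = (\<Sum>u\<in>{v}. c u * mink u v)"
      using assms that by (intro sum.mono_neutral_right) auto
    finally show ?thesis using assms(3) that by simp
  qed
  then show ?thesis
    using assms(1) by (simp add: dependent_finite) blast
qed

text \<open>A Euclidean normal to the span becomes a Minkowski normal once its time coordinate
  changes sign.\<close>

lemma ex_mink_orthogonal:
  fixes S :: "(real \<times> 'a::euclidean_space) set"
  assumes "finite S" "card S < DIM(real \<times> 'a)"
  obtains v where "v \<noteq> 0" "\<And>u. u \<in> S \<Longrightarrow> mink v u = 0"
proof -
  have "dim S < DIM(real \<times> 'a)" using dim_le_card'[OF assms(1)] assms(2) by linarith
  then obtain z where z: "z \<noteq> 0" "\<And>y. y \<in> span S \<Longrightarrow> orthogonal z y"
    using orthogonal_to_subspace_exists by blast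
  show ?thesis
  proof
    show "(- fst z, snd z) \<noteq> 0" using z(1) by (auto simp: prod_eq_iff)
    show "mink (- fst z, snd z) u = 0" if "u \<in> S" for u
      using z(2)[OF span_base[OF that]] by (simp add: mink_def orthogonal_def inner_prod_def)
  qed
qed

lemma spacelike_normalize:
  assumes "mink v v > 0"
  shows "mink ((1 / sqrt (mink v v)) *\<^sub>R v) ((1 / sqrt (mink v v)) *\<^sub>R v) = 1"
  using assms by (simp add: mink_simps divide_simps flip: power2_eq_square)

text \<open>An isometric embedding preserves \<open>mink\<close>, hence is the restriction of a
  linear map \<open>F\<close>. The image of \<open>F\<close> is a subspace of signature (2,1) in a
  space of dimension four, and its orthogonal complement is spanned by the unit normal.\<close>

lemma plane_eq_wall:
  assumes "plane P"
  obtains v where "mink v v = 1" "P = wall v"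
proof -
  from assms obtain f :: "hyp2 \<Rightarrow> hyp3" where f: "isometry_on UNIV f" and P: "P = range f"
    by (auto simp: plane_def)
  note iso = isometry_on_mink[OF f, simplified]
  obtain q0 :: hyp2 where q0: "Rep_hyp q0 = (1, 0)"
    by (rule ex_Rep_hyp[of "(1, 0)"]) (simp_all add: mink_def)
  \<comment> \<open>The time component \<open>sqrt 2\<close> puts a point over each coordinate axis;
    subtracting \<open>sqrt 2\<close> times the image of the base point then yields the images of
    the space axes.\<close>
  obtain q1 :: hyp2 where q1: "Rep_hyp q1 = (sqrt 2, axis 1 1)"
    by (rule ex_Rep_hyp[of "(sqrt 2, axis 1 1 :: real^2)"]) (simp_all add: mink_def inner_axis_axis inner_real_def)
  obtain q2 :: hyp2 where q2: "Rep_hyp q2 = (sqrt 2, axis 2 1)"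
    by (rule ex_Rep_hyp[of "(sqrt 2, axis 2 1 :: real^2)"]) (simp_all add: mink_def inner_axis_axis inner_real_def)
  define E0 where "E0 = Rep_hyp (f q0)"
  define E1 where "E1 = Rep_hyp (f q1) - sqrt 2 *\<^sub>R E0"
  define E2 where "E2 = Rep_hyp (f q2) - sqrt 2 *\<^sub>R E0"
  have fE: "mink (Rep_hyp (f p)) E0 = - fst (Rep_hyp p)"
      "mink (Rep_hyp (f p)) E1 = snd (Rep_hyp p) $ 1"
      "mink (Rep_hyp (f p)) E2 = snd (Rep_hyp p) $ 2" for p
    by (simp_all add: E0_def E1_def E2_def mink_simps iso q0 q1 q2)
       (simp_all add: mink_def inner_axis)
  have E0: "mink E0 E0 = -1" "mink E0 E1 = 0" "mink E0 E2 = 0"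
    using fE[of q0] by (simp_all add: q0 flip: E0_def)
  have fq: "Rep_hyp (f q1) = E1 + sqrt 2 *\<^sub>R E0" "Rep_hyp (f q2) = E2 + sqrt 2 *\<^sub>R E0"
    by (simp_all add: E1_def E2_def)
  have EE: "mink E0 E0 = -1" "mink E0 E1 = 0" "mink E0 E2 = 0" "mink E1 E0 = 0" "mink E2 E0 = 0"
      "mink E1 E1 = 1" "mink E2 E2 = 1" "mink E1 E2 = 0" "mink E2 E1 = 0"
    using fE[of q1] fE[of q2] by (simp_all add: fq q1 q2 axis_def mink_simps E0)
  define F where "F z = fst z *\<^sub>R E0 + (snd z $ 1) *\<^sub>R E1 + (snd z $ 2) *\<^sub>R E2"
    for z :: "real \<times> (real^2)"
  have FF: "mink (F y) (F z) = mink y z" for y z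
    by (simp add: F_def mink_simps EE) (simp add: mink_def inner_vec_def sum_2)
  have fF: "mink (Rep_hyp (f p)) (F z) = mink (Rep_hyp p) z" for p z
    by (simp add: F_def mink_simps fE) (simp add: mink_def inner_vec_def sum_2)
  have FE0: "mink (F z) E0 = - fst z" for z by (simp add: F_def mink_simps EE)
  \<comment> \<open>The difference has square 0 and is orthogonal to a point of the sheet, on whose
    complement the form is definite.\<close>
  have Rep_f: "Rep_hyp (f p) = F (Rep_hyp p)" for p
  proof -
    let ?u = "Rep_hyp (f p) - F (Rep_hyp p)"
    have "mink ?u (Rep_hyp (f q0)) = 0"
      by (simp add: mink_simps fE FE0 flip: E0_def)
    moreover have "mink ?u ?u = 0"
      by (simp add: mink_simps fF FF mink_commute[of "F _" "Rep_hyp _"])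
    ultimately have "?u = 0" by (rule mink_orth_Rep(2))
    then show ?thesis by simp
  qed
  \<comment> \<open>Three vectors do not span dimension four, so a normal exists; being orthogonal
    to the timelike \<open>E0\<close>, it is spacelike and can be normalised.\<close>
  have "card {E0, E1, E2} \<le> 3" by (simp add: card_insert_if)
  then obtain v' where v': "v' \<noteq> 0" "\<And>u. u \<in> {E0, E1, E2} \<Longrightarrow> mink v' u = 0"
    using ex_mink_orthogonal[of "{E0, E1, E2}"] by (auto simp: DIM_prod)
  have nn: "mink u u > 0" if "mink u E0 = 0" "u \<noteq> 0" for u
    using mink_orth_Rep[of u "f q0"] that by (fastforce simp: E0_def)
  define v where "v = (1 / sqrt (mink v' v')) *\<^sub>R v'"
  have v1: "mink v v = 1" unfolding v_def by (rule spacelike_normalize) (simp add: nn v')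
  have vE: "mink v E0 = 0" "mink v E1 = 0" "mink v E2 = 0"
    using v' by (simp_all add: v_def mink_simps)
  have "f p \<in> wall v" for p
    by (simp add: mem_wall Rep_f F_def mink_simps vE)
  moreover have "q \<in> range f" if "q \<in> wall v" for q
  proof -
    let ?q = "Rep_hyp q"
    define z :: "real \<times> (real^2)" where "z = (- mink ?q E0, vector [mink ?q E1, mink ?q E2])"
    define u where "u = ?q - F z"
    have u: "mink u E0 = 0" "mink u E1 = 0" "mink u E2 = 0" "mink u v = 0"
      using that by (simp_all add: u_def z_def F_def mink_simps EE vE mem_wall
          mink_commute[of _ v])
    \<comment> \<open>A nonzero remainder would be the fifth member of an orthogonal system in
      dimension four.\<close>
    have "u = 0"
    proof (rule ccontr)
      assume "u \<noteq> 0"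
      then have uu: "mink u u > 0" using nn u by blast
      have "mink E0 v = 0" "mink E1 v = 0" "mink E2 v = 0"
          "mink E0 u = 0" "mink E1 u = 0" "mink E2 u = 0" "mink v u = 0"
        using vE u by (simp_all add: mink_commute)
      note 0 = this EE v1 vE u
      have ne: "x \<noteq> y" if "mink x y = 0" "mink x x \<noteq> 0" for x y using that by auto
      have "distinct [E0, E1, E2, v, u]"
        by (simp add: 0 ne)
      then have "card (set [E0, E1, E2, v, u]) = 5" by (subst distinct_card) simp_all
      moreover have "independent (set [E0, E1, E2, v, u])"
        by (rule independent_mink_orthogonal) (use 0 uu in auto)
      ultimately show False
        using independent_bound_general[of "set [E0, E1, E2, v, u]"]
          dim_subset_UNIV[of "set [E0, E1, E2, v, u]"] by (simp add: DIM_prod)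
    qed
    then have q: "?q = F z" by (simp add: u_def)
    then have "mink z z = -1" using FF[of z z] mink_Rep_self[of q] by simp
    then show ?thesis
    proof (rule ex_Rep_hyp_uminus)
      fix p assume "Rep_hyp p = z"
      then have "Rep_hyp (f p) = ?q" by (simp add: Rep_f q)
      then show ?thesis by (metis Rep_hyp_inject rangeI)
    next
      \<comment> \<open>Impossible: \<open>f p\<close> and \<open>q\<close> would lie on opposite
        sheets.\<close>
      fix p assume "Rep_hyp p = - z"
      then have "Rep_hyp (f p) = - ?q" by (simp add: Rep_f q F_def)
      then show ?thesis using fst_Rep_pos[of "f p"] fst_Rep_pos[of q] by simp
    qed
  qed
  ultimately have "P = wall v" using P by auto
  with v1 show ?thesis using that by blast
qed

text \<open>On a component of the complement \<open>mink v\<close> is continuous without zeros, so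
  connectedness fixes its sign; the closure keeps the weak inequality.\<close>

lemma half_space_side:
  assumes "half_space (wall v) K"
  shows "(\<forall>p\<in>K. mink v (Rep_hyp p) \<le> 0) \<or> (\<forall>p\<in>K. mink v (Rep_hyp p) \<ge> 0)"
proof -
  from assms obtain C where C: "C \<in> components (- wall v)" "K = closure C"
    by (auto simp: half_space_def)
  let ?g = "\<lambda>p. mink v (Rep_hyp p)"
  have "connected (?g ` C)"
    by (intro connected_continuous_image continuous_on_mink_Rep in_components_connected[OF C(1)])
  moreover have "0 \<notin> ?g ` C"
    using in_components_subset[OF C(1)] by (auto simp: mem_wall)
  ultimately have "?g ` C \<subseteq> {..0} \<or> ?g ` C \<subseteq> {0..}"
    using connected_contains_Icc[of "?g ` C"] by (smt (verit) atLeastAtMost_iff atLeast_iff atMost_iff subset_iff)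
  moreover have "K \<subseteq> ?g -` A" if "?g ` C \<subseteq> A" "closed A" for A
    unfolding C(2) using that
    by (intro closure_minimal closed_vimage continuous_on_mink_Rep) auto
  ultimately show ?thesis by (meson atLeast_iff atMost_iff closed_atLeast closed_atMost subsetD vimageE)
qed

section \<open>Relative position of two walls\<close>

text \<open>The two normals span a positive definite plane, so projecting \<open>(1, 0)\<close> off
  this plane leaves a timelike vector.\<close>

lemma wall_inter_wall:
  assumes "mink v v = 1" "mink w w = 1" "\<bar>mink v w\<bar> < 1"
  shows "wall v \<inter> wall w \<noteq> {}"
proof -
  let ?s = "mink v w" and ?e = "(1, 0) :: real \<times> 'a"
  have s: "?s\<^sup>2 < 1" using assms(3) by (simp add: abs_square_less_1)
  \<comment> \<open>The solution of the Gram system of \<open>v\<close> and \<open>w\<close>, whose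
    determinant is \<open>1 - ?s\<^sup>2\<close>.\<close>
  define \<alpha> \<beta> where "\<alpha> = (mink v ?e - ?s * mink w ?e) / (1 - ?s\<^sup>2)"
    and "\<beta> = (mink w ?e - ?s * mink v ?e) / (1 - ?s\<^sup>2)"
  have eqs: "mink v ?e = \<alpha> + ?s * \<beta>" "mink w ?e = \<beta> + ?s * \<alpha>"
    using s by (simp_all add: \<alpha>_def \<beta>_def eq_divide_eq power2_eq_square algebra_simps flip: add_divide_distrib)
  define u where "u = ?e - \<alpha> *\<^sub>R v - \<beta> *\<^sub>R w"
  have u: "mink v u = 0" "mink w u = 0"
    by (simp_all add: u_def mink_simps assms(1,2) eqs mink_commute[of w v])
  have "mink u u = -1 - (\<alpha> * (\<alpha> + ?s * \<beta>) + \<beta> * (\<beta> + ?s * \<alpha>))"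
    by (simp add: u_def mink_simps assms(1,2) eqs mink_commute[of w v]
        mink_commute[of ?e v] mink_commute[of ?e w] algebra_simps)
       (simp add: mink_def)
  also have "\<dots> = -1 - (\<alpha> + ?s * \<beta>)\<^sup>2 - (1 - ?s\<^sup>2) * \<beta>\<^sup>2"
    by (simp add: power2_eq_square algebra_simps)
  also have "\<dots> < 0"
    using s by (smt (verit) mult_nonneg_nonneg zero_le_power2)
  finally obtain p c where "Rep_hyp p = c *\<^sub>R u" by (rule timelike_scale_Rep)
  then have "p \<in> wall v \<inter> wall w" by (simp add: mem_wall mink_simps u)
  then show ?thesis by blast
qed

text \<open>The curve is \<open>cosh t\<close> times \<open>p\<close> plus \<open>sinh t\<close>
  times the unit tangent at \<open>p\<close> pointing towards the null direction \<open>n\<close>.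
  It stays in the wall because both \<open>p\<close> and \<open>n\<close> are orthogonal to
  \<open>v\<close>.\<close>

lemma null_ray:
  assumes n: "mink n n = 0" "fst n > 0" and v: "mink v n = 0" and p: "p \<in> wall v"
  obtains r where "geodesic_ray r" "r ` {0..} \<subseteq> wall v"
    "\<And>t. t \<ge> 0 \<Longrightarrow> Rep_hyp (r t) = exp (- t) *\<^sub>R Rep_hyp p - (sinh t / mink n (Rep_hyp p)) *\<^sub>R n"
proof -
  define k where "k = mink n (Rep_hyp p)"
  have k: "k < 0" unfolding k_def by (rule null_future_mink_neg[OF n])
  define w where "w t = exp (- t) *\<^sub>R Rep_hyp p - (sinh t / k) *\<^sub>R n" for t :: real
  have ww: "mink (w s) (w t) = - cosh (s - t)" for s t
  proof -
    have "mink (w s) (w t) = - (exp (- s) * exp (- t)) - exp (- s) * sinh t - exp (- t) * sinh s"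
      using k by (simp add: w_def mink_simps n mink_commute[of "Rep_hyp p"] flip: k_def)
         (simp add: field_simps)
    also have "\<dots> = - cosh (s - t)"
      by (simp add: sinh_field_def cosh_field_def field_simps exp_diff exp_minus)
    finally show ?thesis .
  qed
  have "\<exists>q. Rep_hyp q = w t" if "t \<ge> 0" for t
  proof (rule ex_Rep_hyp[of "w t"])
    show "mink (w t) (w t) = -1" by (simp add: ww)
    \<comment> \<open>As \<open>k < 0\<close>, the coefficient of the future vector \<open>n\<close>
      is nonnegative, which keeps the curve on the upper sheet.\<close>
    have "- (sinh t / k) \<ge> 0" using that k by (simp add: divide_nonneg_neg)
    then have "- (sinh t / k) * fst n \<ge> 0" using n(2) by (simp only: mult_nonneg_nonneg less_imp_le)
    then show "fst (w t) > 0"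
      by (simp add: w_def) (smt (verit) fst_Rep_pos exp_gt_zero mult_pos_pos)
  qed blast
  then obtain r where r: "Rep_hyp (r t) = w t" if "t \<ge> 0" for t by metis
  show ?thesis
  proof
    show "Rep_hyp (r t) = exp (- t) *\<^sub>R Rep_hyp p - (sinh t / mink n (Rep_hyp p)) *\<^sub>R n"
      if "t \<ge> 0" for t using r[OF that] by (simp add: w_def k_def)
    show "r ` {0..} \<subseteq> wall v"
      using p v by (auto simp: mem_wall r w_def mink_simps)
    have "dist (r s) (r t) = dist s t" if "s \<ge> 0" "t \<ge> 0" for s t
    proof -
      have "dist (r s) (r t) = arcosh (cosh \<bar>s - t\<bar>)"
        using that by (simp add: dist_hyp_def r ww)
      also have "\<dots> = \<bar>s - t\<bar>" by (rule arcosh_cosh_real) simp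
      finally show ?thesis by (simp add: dist_real_def)
    qed
    then show "geodesic_ray r" by (simp add: geodesic_ray_def isometry_on_def)
  qed
qed

lemma asymptotic_class_mono:
  assumes "bounded ((\<lambda>t. dist (r t) (s t)) ` {0..})"
  shows "asymptotic_class r \<subseteq> asymptotic_class s"
proof
  fix q assume q: "q \<in> asymptotic_class r"
  from assms obtain A where A: "\<And>t. t \<ge> 0 \<Longrightarrow> dist (r t) (s t) \<le> A"
    by (auto simp: bounded_iff)
  from q obtain B where B: "\<And>t. t \<ge> 0 \<Longrightarrow> dist (r t) (q t) \<le> B"
    by (auto simp: bounded_iff asymptotic_class_def)
  have "dist (s t) (q t) \<le> A + B" if "t \<ge> 0" for t
    using A[OF that] B[OF that] dist_triangle[of "s t" "q t" "r t"] by (simp add: dist_commute)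
  then show "q \<in> asymptotic_class s"
    using q by (auto simp: asymptotic_class_def bounded_iff)
qed

lemma asymptotic_class_eq:
  assumes "bounded ((\<lambda>t. dist (r t) (s t)) ` {0..})"
  shows "asymptotic_class r = asymptotic_class s"
  using asymptotic_class_mono[OF assms] asymptotic_class_mono[of s r] assms
  by (simp add: dist_commute)

lemma exp_minus_sinh_le: "exp (- t) * sinh t \<le> (1::real)"
proof -
  have "exp (- t) * sinh t = 1 / 2 - exp (- t - t) / 2"
    by (simp add: sinh_field_def field_simps flip: exp_add)
  then show ?thesis using exp_gt_zero[of "- t - t"] by linarith
qed

text \<open>A null vector orthogonal to both normals represents a common ideal point: the rays
  towards it inside the two walls stay at bounded distance.\<close>

lemma wall_ideal_boundary_inter:
  assumes n: "mink n n = 0" "n \<noteq> 0" and vw: "mink v n = 0" "mink w n = 0"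
    and ne: "wall v \<noteq> {}" "wall w \<noteq> {}"
  shows "ideal_boundary (wall v) \<inter> ideal_boundary (wall w) \<noteq> {}"
proof -
  have *: ?thesis if n: "mink n n = 0" "fst n > 0" and vw: "mink v n = 0" "mink w n = 0" for n
  proof -
    from ne obtain p q where p: "p \<in> wall v" and q: "q \<in> wall w" by blast
    obtain r where r: "geodesic_ray r" "r ` {0..} \<subseteq> wall v"
      "\<And>t. t \<ge> 0 \<Longrightarrow> Rep_hyp (r t) = exp (- t) *\<^sub>R Rep_hyp p - (sinh t / mink n (Rep_hyp p)) *\<^sub>R n"
      using null_ray[OF n vw(1) p] by blast
    obtain s where s: "geodesic_ray s" "s ` {0..} \<subseteq> wall w"
      "\<And>t. t \<ge> 0 \<Longrightarrow> Rep_hyp (s t) = exp (- t) *\<^sub>R Rep_hyp q - (sinh t / mink n (Rep_hyp q)) *\<^sub>R n"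
      using null_ray[OF n vw(2) q] by blast
    let ?a = "mink n (Rep_hyp p)" and ?b = "mink n (Rep_hyp q)"
    let ?M = "cosh (dist p q) + ?a / ?b + ?b / ?a"
    have ab: "?a < 0" "?b < 0" using null_future_mink_neg[OF n] by auto
    have "dist (r t) (s t) \<le> arcosh ?M" if t: "t \<ge> 0" for t
    proof -
      \<comment> \<open>Since \<open>n\<close> is null, the growing product of the two
        \<open>sinh t\<close> terms drops out and only bounded terms remain.\<close>
      have "cosh (dist (r t) (s t)) = exp (- t) * exp (- t) * cosh (dist p q)
          + exp (- t) * sinh t * (?a / ?b) + exp (- t) * sinh t * (?b / ?a)"
        using mink_Rep_Rep[of "r t" "s t"] ab
        by (simp add: r(3)[OF t] s(3)[OF t] mink_simps n mink_Rep_Rep mink_commute[of "Rep_hyp p" n] algebra_simps)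
      also have "\<dots> \<le> 1 * cosh (dist p q) + 1 * (?a / ?b) + 1 * (?b / ?a)"
        using ab t exp_minus_sinh_le[of t]
        by (intro add_mono mult_right_mono) (auto simp: divide_nonpos_neg mult_le_one intro: divide_nonpos_nonpos)
      finally have le: "cosh (dist (r t) (s t)) \<le> ?M" by simp
      then have M: "?M \<ge> 1" using cosh_real_ge_1[of "dist (r t) (s t)"] by linarith
      with le have "cosh (dist (r t) (s t)) \<le> cosh (arcosh ?M)" by simp
      moreover have "arcosh ?M \<ge> 0" using M by (rule arcosh_nonneg_real)
      ultimately show ?thesis by (simp only: cosh_real_nonneg_le_iff zero_le_dist)
    qed
    then have "bounded ((\<lambda>t. dist (r t) (s t)) ` {0..})" by (auto simp: bounded_iff)
    then have "asymptotic_class r = asymptotic_class s" by (rule asymptotic_class_eq)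
    then show ?thesis using r(1,2) s(1,2) unfolding ideal_boundary_def by blast
  qed
  have "fst n \<noteq> 0"
  proof
    assume "fst n = 0"
    with n show False by (auto simp: mink_def prod_eq_iff)
  qed
  then show ?thesis using *[of n] *[of "- n"] n vw by fastforce
qed

text \<open>The foot on \<open>wall v\<close> of the common perpendicular is the part of
  \<open>w\<close> orthogonal to \<open>v\<close>, which is timelike here. The sign of
  \<open>c\<close> stays open, since it depends on the sheet; the side conditions settle it
  later.\<close>

lemma foot_exists:
  assumes v: "mink v v = 1" and w: "mink w w = 1" and s: "\<bar>mink v w\<bar> > 1"
  obtains p c where "Rep_hyp p = c *\<^sub>R (w - mink v w *\<^sub>R v)" "p \<in> wall v" "c\<^sup>2 * ((mink v w)\<^sup>2 - 1) = 1"
proof -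
  let ?w = "w - mink v w *\<^sub>R v"
  have ww: "mink ?w ?w = 1 - (mink v w)\<^sup>2"
    using v w by (simp add: mink_simps mink_commute[of w v] power2_eq_square)
  have "(mink v w)\<^sup>2 > 1" using s abs_square_le_1[of "mink v w"] by linarith
  then have "mink ?w ?w < 0" using ww by simp
  then obtain p c where p: "Rep_hyp p = c *\<^sub>R ?w" by (rule timelike_scale_Rep)
  have "c\<^sup>2 * mink ?w ?w = -1" using mink_Rep_self[of p] by (simp only: p mink_simps(3,6)) (simp add: power2_eq_square)
  then have "c\<^sup>2 * ((mink v w)\<^sup>2 - 1) = 1" by (simp add: ww algebra_simps)
  moreover have "p \<in> wall v" by (simp add: mem_wall p mink_simps v)
  ultimately show ?thesis using p that by blast
qed

text \<open>The other values are excluded in turn: absolute value below 1 makes the walls meet,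
  absolute value 1 gives a common ideal point, and a value above 1 contradicts the sides.\<close>

lemma outward_normals:
  assumes v: "mink v v = 1" and w: "mink w w = 1"
    and disjoint: "wall v \<inter> wall w = {}"
    and ideal: "ideal_boundary (wall v) \<inter> ideal_boundary (wall w) = {}"
    and sides: "\<And>p. p \<in> wall w \<Longrightarrow> mink v (Rep_hyp p) \<le> 0" "\<And>p. p \<in> wall v \<Longrightarrow> mink w (Rep_hyp p) \<le> 0"
  shows "mink v w < -1"
proof (rule ccontr)
  let ?s = "mink v w"
  assume "\<not> ?s < -1"
  then consider "\<bar>?s\<bar> < 1" | "?s\<^sup>2 = 1" | "?s > 1"
    by (metis abs_less_iff linorder_neqE_linordered_idom minus_less_iff power2_minus power_one)
  then show False
  proof cases
    case 1
    with wall_inter_wall v w disjoint show False by blast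
  next
    case 2
    \<comment> \<open>In the borderline case this component is null and orthogonal to both normals;
      it can vanish only if \<open>wall v\<close> lies in \<open>wall w\<close>.\<close>
    let ?n = "w - ?s *\<^sub>R v"
    have n: "mink ?n ?n = 0" "mink v ?n = 0" "mink w ?n = 0"
      using 2 by (simp_all add: mink_simps v w mink_commute[of w v] power2_eq_square)
    have "?n \<noteq> 0"
    proof
      assume "?n = 0"
      then have "w = ?s *\<^sub>R v" by simp
      then have "wall v \<subseteq> wall w" by (metis mem_wall mink_simps(3) mult_zero_right subsetI)
      with disjoint wall_nonempty[OF v] show False by blast
    qed
    with n wall_ideal_boundary_inter wall_nonempty[OF v] wall_nonempty[OF w] ideal show False by blast
  next
    case 3
    then have s: "\<bar>?s\<bar> > 1" "\<bar>mink w v\<bar> > 1" "?s\<^sup>2 > 1"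
      by (simp_all add: mink_commute[of w v])
    obtain p c where p: "Rep_hyp p = c *\<^sub>R (w - ?s *\<^sub>R v)" "p \<in> wall v"
      using foot_exists[OF v w s(1)] by blast
    obtain q d where q: "Rep_hyp q = d *\<^sub>R (v - ?s *\<^sub>R w)" "q \<in> wall w"
      using foot_exists[OF w v s(2)] by (metis mink_commute)
    \<comment> \<open>The sides make both scale factors nonnegative, and then the feet have a
      nonnegative product, impossible for two points of the sheet.\<close>
    have "c * (1 - ?s\<^sup>2) \<le> 0" "d * (1 - ?s\<^sup>2) \<le> 0"
      using sides(2)[OF p(2)] sides(1)[OF q(2)]
      by (simp_all add: p q mink_simps v w mink_commute[of w v] power2_eq_square)
    then have cd: "c \<ge> 0" "d \<ge> 0" using s(3) by (simp_all add: mult_le_0_iff)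
    have "mink (Rep_hyp p) (Rep_hyp q) = (c * d) * (?s * (?s\<^sup>2 - 1))"
      by (simp add: p q mink_simps v w mink_commute[of w v] power2_eq_square algebra_simps)
    also have "\<dots> \<ge> 0" using cd 3 s(3) by simp
    finally show False using mink_Rep_le[of p q] by linarith
  qed
qed

section \<open>Geodesic arcs\<close>

text \<open>The distance of the endpoints is the largest distance within the arc, so the bare point
  set determines it and the \<open>THE\<close> is well defined.\<close>

lemma arc_length_eq:
  assumes "geodesic_arc p q \<gamma>"
  shows "arc_length \<gamma> = dist p q"
proof -
  have le: "dist u u' \<le> dist p q" if "geodesic_arc p q \<gamma>" "u \<in> \<gamma>" "u' \<in> \<gamma>" for p q u u' :: 'a
  proof -
    from that(1) obtain f where f: "isometry_on {0..dist p q} f" "\<gamma> = f ` {0..dist p q}"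
      by (auto simp: geodesic_arc_def)
    with that(2,3) obtain s t where "u = f s" "u' = f t" "s \<in> {0..dist p q}" "t \<in> {0..dist p q}"
      by blast
    with f show ?thesis by (auto simp: isometry_on_def dist_real_def)
  qed
  have ends: "p \<in> \<gamma>" "q \<in> \<gamma>" if "geodesic_arc p q \<gamma>" for p q :: 'a
  proof -
    from that obtain f where "f 0 = p" "f (dist p q) = q" "\<gamma> = f ` {0..dist p q}"
      unfolding geodesic_arc_def by blast
    moreover have "f 0 \<in> f ` {0..dist p q}" "f (dist p q) \<in> f ` {0..dist p q}" by simp_all
    ultimately show "p \<in> \<gamma>" "q \<in> \<gamma>" by metis+
  qed
  show ?thesis
    unfolding arc_length_def
  proof (rule the_equality)
    fix r assume "\<exists>p q. geodesic_arc p q \<gamma> \<and> r = dist p q"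
    then obtain p' q' where pq': "geodesic_arc p' q' \<gamma>" "r = dist p' q'" by blast
    show "r = dist p q"
      unfolding pq'(2)
      by (rule order_antisym[OF le[OF assms ends[OF pq'(1)]] le[OF pq'(1) ends[OF assms]]])
  qed (use assms in blast)
qed

lemma geodesic_arc_singleton: "geodesic_arc p p {p}"
  by (auto simp: geodesic_arc_def isometry_on_def)

lemma compact_geodesic_arc:
  assumes "geodesic_arc p q \<gamma>"
  shows "compact \<gamma>"
proof -
  from assms obtain f where f: "isometry_on {0..dist p q} f" "\<gamma> = f ` {0..dist p q}"
    by (auto simp: geodesic_arc_def)
  from f(1) have "continuous_on {0..dist p q} f"
    unfolding continuous_on_iff isometry_on_def by metis
  then show ?thesis unfolding f(2) by (rule compact_continuous_image) simp
qed

section \<open>Explicit geodesic segments and shortest arcs\<close>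

text \<open>Hyperbolic spherical interpolation: the point at distance \<open>t\<close> from
  \<open>p\<close> on the way to \<open>q\<close>. For \<open>p = q\<close> division by zero gives
  the vector 0, so that case is treated separately.\<close>

definition geodesic_point :: "'a::real_inner hyp \<Rightarrow> 'a hyp \<Rightarrow> real \<Rightarrow> real \<times> 'a" where
  "geodesic_point p q t = (sinh (dist p q - t) / sinh (dist p q)) *\<^sub>R Rep_hyp p
     + (sinh t / sinh (dist p q)) *\<^sub>R Rep_hyp q"

lemma mink_geodesic_point:
  assumes "p \<noteq> q"
  shows "mink (geodesic_point p q s) (geodesic_point p q t) = - cosh (s - t)"
proof -
  let ?S = "sinh (dist p q)" and ?C = "cosh (dist p q)"
  \<comment> \<open>The unit tangent at \<open>p\<close> towards \<open>q\<close>.\<close>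
  define w where "w = (1 / ?S) *\<^sub>R (Rep_hyp q - ?C *\<^sub>R Rep_hyp p)"
  have S: "?S > 0" using assms by simp
  have g: "geodesic_point p q t = cosh t *\<^sub>R Rep_hyp p + sinh t *\<^sub>R w" for t
    using S by (simp add: geodesic_point_def w_def sinh_diff diff_divide_distrib algebra_simps)
  have pq: "mink (Rep_hyp p) (Rep_hyp q) = - ?C" "mink (Rep_hyp q) (Rep_hyp p) = - ?C"
    by (simp_all add: mink_Rep_Rep dist_commute)
  have w: "mink w (Rep_hyp p) = 0" "mink (Rep_hyp p) w = 0"
    by (simp_all add: w_def mink_simps pq)
  have "mink w w = (?C\<^sup>2 - 1) / ?S\<^sup>2"
    by (simp add: w_def mink_simps pq power2_eq_square diff_divide_distrib)
  also have "\<dots> = 1" using S by (simp add: cosh_square_eq)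
  finally show ?thesis by (simp add: g mink_simps w cosh_diff)
qed

lemma geodesic_point_exists:
  assumes "p \<noteq> q" "t \<in> {0..dist p q}"
  obtains z where "Rep_hyp z = geodesic_point p q t"
proof (rule ex_Rep_hyp)
  let ?d = "dist p q"
  show "mink (geodesic_point p q t) (geodesic_point p q t) = -1"
    by (simp add: mink_geodesic_point assms)
  have "sinh ?d > 0" using assms by simp
  moreover have "sinh (?d - t) \<ge> 0" "sinh t \<ge> 0" "sinh (?d - t) > 0 \<or> sinh t > 0"
    using assms by (auto simp: less_le)
  ultimately have "sinh (?d - t) / sinh ?d * fst (Rep_hyp p) + sinh t / sinh ?d * fst (Rep_hyp q) > 0"
    by (metis add_nonneg_pos add_pos_nonneg divide_nonneg_pos divide_pos_pos fst_Rep_pos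
        less_imp_le mult_nonneg_nonneg mult_pos_pos)
  then show "fst (geodesic_point p q t) > 0" by (simp add: geodesic_point_def)
qed (use that in blast)

lemma geodesic_arc_exists: "\<exists>\<gamma>. geodesic_arc (p :: 'a::real_inner hyp) q \<gamma>"
proof (cases "p = q")
  case True
  then show ?thesis using geodesic_arc_singleton by blast
next
  case False
  let ?I = "{0..dist p q}"
  have "\<forall>t\<in>?I. \<exists>z. Rep_hyp z = geodesic_point p q t"
    using geodesic_point_exists[OF False] by blast
  then obtain f where f: "\<And>t. t \<in> ?I \<Longrightarrow> Rep_hyp (f t) = geodesic_point p q t"
    by metis
  have "f 0 = p" "f (dist p q) = q"
    using False f[of 0] f[of "dist p q"] by (simp_all add: geodesic_point_def Rep_hyp_inject)
  moreover have "isometry_on ?I f"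
    unfolding isometry_on_def
  proof safe
    fix s t assume "s \<in> ?I" "t \<in> ?I"
    then have "dist (f s) (f t) = arcosh (cosh \<bar>s - t\<bar>)"
      by (simp add: dist_hyp_def f mink_geodesic_point False)
    also have "\<dots> = dist s t" by (subst arcosh_cosh_real) (simp_all add: dist_real_def)
    finally show "dist (f s) (f t) = dist s t" .
  qed
  ultimately show ?thesis unfolding geodesic_arc_def by blast
qed

text \<open>Uniqueness of geodesics: a point at distance \<open>t\<close> from \<open>p\<close> and
  \<open>dist p q - t\<close> from \<open>q\<close> has product -1 with the explicit point, by the
  addition formula for \<open>sinh\<close>, and so coincides with it.\<close>

lemma geodesic_arc_Rep:
  assumes "geodesic_arc p q \<gamma>" "p \<noteq> q"
  shows "Rep_hyp ` \<gamma> = geodesic_point p q ` {0..dist p q}"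
proof -
  let ?d = "dist p q"
  from assms(1) obtain f where f: "isometry_on {0..?d} f" "f 0 = p" "f ?d = q" and \<gamma>: "\<gamma> = f ` {0..?d}"
    by (auto simp: geodesic_arc_def)
  have "Rep_hyp (f t) = geodesic_point p q t" if t: "t \<in> {0..?d}" for t
  proof -
    obtain z where z: "Rep_hyp z = geodesic_point p q t"
      using geodesic_point_exists[OF assms(2) t] .
    have iso: "dist (f s) (f t) = dist s t" if "s \<in> {0..?d}" for s
      using f(1) t that by (simp add: isometry_on_def)
    have "dist p (f t) = dist 0 t" "dist q (f t) = dist ?d t"
      using iso[of 0] iso[of ?d] f(2,3) by simp_all
    then have "dist p (f t) = t" "dist q (f t) = ?d - t" using t by (auto simp: dist_real_def)
    then have "mink (Rep_hyp z) (Rep_hyp (f t))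
        = - ((sinh (?d - t) * cosh t + cosh (?d - t) * sinh t) / sinh ?d)"
      by (simp add: z geodesic_point_def mink_simps mink_Rep_Rep add_divide_distrib)
    also have "\<dots> = -1" using assms(2) by (simp flip: sinh_add)
    finally have "z = f t" by (simp add: mink_Rep_eq_iff)
    with z show ?thesis by simp
  qed
  then show ?thesis by (simp add: \<gamma> image_image)
qed

text \<open>\<open>shortest_arc\<close> is a \<open>SOME\<close> choice. An attained minimum shows
  that a shortest arc exists, but the chosen one may have other endpoints at the same
  distance.\<close>

lemma shortest_arc_minimal:
  fixes A B :: "'a::real_inner hyp set"
  assumes "p \<in> A" "q \<in> B" "\<And>p' q'. p' \<in> A \<Longrightarrow> q' \<in> B \<Longrightarrow> dist p q \<le> dist p' q'"
  obtains p' q' where "p' \<in> A" "q' \<in> B" "geodesic_arc p' q' (shortest_arc A B)" "dist p' q' = dist p q"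
proof -
  obtain \<gamma> where "geodesic_arc p q \<gamma>" using geodesic_arc_exists by blast
  then have "is_shortest_arc A B \<gamma>"
    using assms by (auto simp: is_shortest_arc_def arc_length_eq)
  then have s: "is_shortest_arc A B (shortest_arc A B)"
    unfolding shortest_arc_def by (rule someI)
  then obtain p' q' where pq': "p' \<in> A" "q' \<in> B" "geodesic_arc p' q' (shortest_arc A B)"
    unfolding is_shortest_arc_def by blast
  have "dist p' q' \<le> dist p q"
    using s \<open>geodesic_arc p q \<gamma>\<close> assms(1,2) pq'(3) by (auto simp: is_shortest_arc_def arc_length_eq)
  with assms(3)[OF pq'(1,2)] pq' show ?thesis using that by force
qed

section \<open>The common perpendicular of two walls\<close>

lemma outward_foot:
  assumes v: "mink v v = 1" and w: "mink w w = 1" and s: "mink v w < -1"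
    and side: "\<And>p. p \<in> wall v \<Longrightarrow> mink w (Rep_hyp p) \<le> 0"
  obtains p where "p \<in> wall v" "Rep_hyp p = (1 / sqrt ((mink v w)\<^sup>2 - 1)) *\<^sub>R (w - mink v w *\<^sub>R v)"
proof -
  let ?s = "mink v w"
  have s2: "?s\<^sup>2 > 1" using s abs_square_le_1[of ?s] by linarith
  obtain p c where p: "Rep_hyp p = c *\<^sub>R (w - ?s *\<^sub>R v)" "p \<in> wall v" and c: "c\<^sup>2 * (?s\<^sup>2 - 1) = 1"
    using foot_exists[OF v w] s by auto
  have "c * (1 - ?s\<^sup>2) \<le> 0"
    using side[OF p(2)] by (simp add: p mink_simps w mink_commute[of w v] power2_eq_square)
  then have "c \<ge> 0" using s2 by (simp add: mult_le_0_iff)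
  moreover have "c\<^sup>2 = 1 / (?s\<^sup>2 - 1)" using c s2 by (simp add: eq_divide_eq)
  ultimately have "c = 1 / sqrt (?s\<^sup>2 - 1)"
    by (metis real_sqrt_divide real_sqrt_one real_sqrt_unique)
  with p that show ?thesis by simp
qed

text \<open>The span hypotheses say that the geodesic through \<open>p\<close> and \<open>q\<close>
  is perpendicular to both walls. Splitting \<open>p'\<close> along \<open>p\<close> and
  \<open>q'\<close> along \<open>q\<close> leaves remainders \<open>u\<close> and \<open>z\<close>
  with \<open>u\<close> orthogonal to \<open>q\<close> and \<open>z\<close> to \<open>p\<close>;
  Cauchy-Schwarz bounds their product, and any displacement strictly increases the distance.\<close>

lemma foot_minimal:
  assumes p: "p \<in> wall v" and q: "q \<in> wall w" and x: "cosh (dist p q) > 1"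
    and q_span: "Rep_hyp q = a *\<^sub>R Rep_hyp p + b *\<^sub>R v"
    and p_span: "Rep_hyp p = a' *\<^sub>R Rep_hyp q + b' *\<^sub>R w"
    and p': "p' \<in> wall v" and q': "q' \<in> wall w"
  shows "dist p q \<le> dist p' q'" "dist p' q' = dist p q \<Longrightarrow> p' = p \<and> q' = q"
proof -
  let ?x = "cosh (dist p q)" and ?A = "cosh (dist p' p)" and ?B = "cosh (dist q' q)"
  define u where "u = Rep_hyp p' + mink (Rep_hyp p') (Rep_hyp p) *\<^sub>R Rep_hyp p"
  define z where "z = Rep_hyp q' + mink (Rep_hyp q') (Rep_hyp q) *\<^sub>R Rep_hyp q"
  have A: "?A \<ge> 1" and B: "?B \<ge> 1" by (simp_all add: cosh_real_ge_1)
  have up: "mink u (Rep_hyp p) = 0" and uu: "mink u u = ?A\<^sup>2 - 1"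
    unfolding u_def by (simp_all only: mink_Rep_proj) (simp add: mink_Rep_Rep)
  have zq: "mink z (Rep_hyp q) = 0" and zz: "mink z z = ?B\<^sup>2 - 1"
    unfolding z_def by (simp_all only: mink_Rep_proj) (simp add: mink_Rep_Rep)
  have "mink u v = 0"
    using p p' by (simp add: u_def mink_simps mem_wall mink_commute[of _ v])
  then have uq: "mink u (Rep_hyp q) = 0" by (simp add: q_span mink_simps up)
  have "mink z w = 0"
    using q q' by (simp add: z_def mink_simps mem_wall mink_commute[of _ w])
  then have zp: "mink z (Rep_hyp p) = 0" by (simp add: p_span mink_simps zq)
  \<comment> \<open>Cauchy-Schwarz needs both vectors orthogonal to the same point \<open>p\<close>
    and bounds the negated product, hence the use of \<open>- u\<close>.\<close>
  have "mink u z \<le> sqrt (?A\<^sup>2 - 1) * sqrt (?B\<^sup>2 - 1)"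
    using mink_orth_Cauchy_Schwarz[of "- u" p z] by (simp add: up zp uu zz)
  also have "\<dots> \<le> sqrt ((?A * ?B - 1)\<^sup>2)"
  proof -
    have "(?A\<^sup>2 - 1) * (?B\<^sup>2 - 1) = (?A * ?B - 1)\<^sup>2 - (?A - ?B)\<^sup>2"
      by (simp add: power2_eq_square algebra_simps)
    then have "(?A\<^sup>2 - 1) * (?B\<^sup>2 - 1) \<le> (?A * ?B - 1)\<^sup>2" by simp
    then show ?thesis by (metis real_sqrt_le_mono real_sqrt_mult)
  qed
  also have "\<dots> = ?A * ?B - 1"
    using mult_mono[OF A B] A by simp
  finally have uz: "mink u z \<le> ?A * ?B - 1" .
  have Rp': "Rep_hyp p' = ?A *\<^sub>R Rep_hyp p + u" and Rq': "Rep_hyp q' = ?B *\<^sub>R Rep_hyp q + z"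
    by (simp_all add: u_def z_def mink_Rep_Rep)
  have "cosh (dist p' q') = ?A * ?B * ?x - mink u z"
    using mink_Rep_Rep[of p' q']
    by (simp add: Rp' Rq' mink_simps uq mink_commute[of "Rep_hyp p" z] zp mink_Rep_Rep algebra_simps)
  with uz have *: "cosh (dist p' q') \<ge> ?x + (?A * ?B - 1) * (?x - 1)"
    by (simp add: algebra_simps)
  have AB: "?A * ?B - 1 \<ge> ?A - 1" "?A * ?B - 1 \<ge> ?B - 1"
    using A B mult_left_mono[OF B, of ?A] mult_right_mono[OF A, of ?B] by auto
  then have "(?A * ?B - 1) * (?x - 1) \<ge> 0"
    using A x by (intro mult_nonneg_nonneg) linarith+
  with * have "cosh (dist p q) \<le> cosh (dist p' q')" by linarith
  then show "dist p q \<le> dist p' q'" by (simp add: cosh_real_nonneg_le_iff)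
  assume "dist p' q' = dist p q"
  with * have "(?A * ?B - 1) * (?x - 1) \<le> 0" by simp
  with x have "?A * ?B - 1 \<le> 0" by (auto simp: mult_le_0_iff)
  with AB A B have "?A = 1" "?B = 1" by linarith+
  then show "p' = p \<and> q' = q"
    using mink_Rep_Rep[of p' p] mink_Rep_Rep[of q' q] by (simp add: mink_Rep_eq_iff)
qed

lemma shortest_arc_walls:
  assumes v: "mink v v = 1" and w: "mink w w = 1" and s: "mink v w < -1"
    and sides: "\<And>p. p \<in> wall v \<Longrightarrow> mink w (Rep_hyp p) \<le> 0" "\<And>p. p \<in> wall w \<Longrightarrow> mink v (Rep_hyp p) \<le> 0"
  defines "e \<equiv> shortest_arc (wall v) (wall w)"
  shows "cosh (arc_length e) = - mink v w" "compact e"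
    "\<And>z. z \<in> e \<Longrightarrow> \<exists>\<alpha>\<ge>0. \<exists>\<beta>\<ge>0. Rep_hyp z = \<alpha> *\<^sub>R v + \<beta> *\<^sub>R w"
    "\<exists>z\<in>e. \<exists>\<kappa>>0. Rep_hyp z = \<kappa> *\<^sub>R (v + w)"
proof -
  let ?s = "mink v w"
  define r where "r = 1 / sqrt (?s\<^sup>2 - 1)"
  have s2: "?s\<^sup>2 > 1" using s abs_square_le_1[of ?s] by linarith
  then have "r > 0" "r\<^sup>2 * (?s\<^sup>2 - 1) = 1"
    by (simp_all add: r_def power_divide)
  then have r: "r > 0" "r * r * (?s * ?s - 1) = 1" by (simp_all only: power2_eq_square)
  obtain p where p: "p \<in> wall v" "Rep_hyp p = r *\<^sub>R (w - ?s *\<^sub>R v)"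
    using outward_foot[OF v w s sides(1)] unfolding r_def by blast
  obtain q where q: "q \<in> wall w" "Rep_hyp q = r *\<^sub>R (v - ?s *\<^sub>R w)"
    using outward_foot[OF w v _ sides(2)] s unfolding r_def mink_commute[of w v] by blast
  have "mink (Rep_hyp p) (Rep_hyp q) = ?s * (r * r * (?s * ?s - 1))"
    by (simp add: p q mink_simps v w mink_commute[of w v] algebra_simps)
  then have x: "cosh (dist p q) = - ?s" using r(2) by (simp add: mink_Rep_Rep)
  then have "p \<noteq> q" using s by auto
  have span: "Rep_hyp q = (- ?s) *\<^sub>R Rep_hyp p + (r * (1 - ?s * ?s)) *\<^sub>R v"
       "Rep_hyp p = (- ?s) *\<^sub>R Rep_hyp q + (r * (1 - ?s * ?s)) *\<^sub>R w"
    by (simp_all add: p q algebra_simps)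
  have "cosh (dist p q) > 1" using x s by simp
  note min = foot_minimal[OF p(1) q(1) this span]
  obtain p' q' where "p' \<in> wall v" "q' \<in> wall w" "geodesic_arc p' q' e" "dist p' q' = dist p q"
    using shortest_arc_minimal[OF p(1) q(1) min(1)] unfolding e_def by blast
  \<comment> \<open>Uniqueness of the minimising pair identifies the endpoints of the chosen arc
    with the two feet.\<close>
  with min(2) have e: "geodesic_arc p q e" by blast
  show "cosh (arc_length e) = - mink v w" using x by (simp add: arc_length_eq[OF e])
  show "compact e" by (rule compact_geodesic_arc[OF e])
  note Rep_e = geodesic_arc_Rep[OF e \<open>p \<noteq> q\<close>]
  let ?d = "dist p q"
  have d: "?d > 0" "sinh ?d > 0" using \<open>p \<noteq> q\<close> by simp_all
  \<comment> \<open>The arc in coordinates of the normals; as \<open>?s < 0\<close>, both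
    coefficients are nonnegative along it.\<close>
  have gp: "geodesic_point p q t = (r * (sinh t - ?s * sinh (?d - t)) / sinh ?d) *\<^sub>R v
      + (r * (sinh (?d - t) - ?s * sinh t) / sinh ?d) *\<^sub>R w" for t
    by (simp add: geodesic_point_def p q algebra_simps add_divide_distrib diff_divide_distrib)
  show "\<exists>\<alpha>\<ge>0. \<exists>\<beta>\<ge>0. Rep_hyp z = \<alpha> *\<^sub>R v + \<beta> *\<^sub>R w" if "z \<in> e" for z
  proof -
    from that Rep_e obtain t where t: "t \<in> {0..?d}" "Rep_hyp z = geodesic_point p q t" by blast
    then have "0 \<le> sinh t" "0 \<le> sinh (?d - t)" by simp_all
    moreover from this have "?s * sinh t \<le> 0" "?s * sinh (?d - t) \<le> 0"
      using s by (simp_all add: mult_nonpos_nonneg)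
    ultimately have "0 \<le> r * (sinh t - ?s * sinh (?d - t)) / sinh ?d"
        "0 \<le> r * (sinh (?d - t) - ?s * sinh t) / sinh ?d"
      using r(1) d(2) by (intro divide_nonneg_pos mult_nonneg_nonneg; linarith)+
    then show ?thesis using t(2)[unfolded gp] by blast
  qed
  \<comment> \<open>At half the distance the two coefficients agree, so the midpoint is a multiple
    of \<open>v + w\<close>.\<close>
  let ?h = "?d / 2"
  have "?d - ?h = ?h" by simp
  then have "geodesic_point p q ?h = (r * (1 - ?s) * sinh ?h / sinh ?d) *\<^sub>R (v + w)"
    by (simp only: gp) (simp add: algebra_simps)
  moreover have "r * (1 - ?s) * sinh ?h / sinh ?d > 0" using r(1) s d by simp
  moreover have "geodesic_point p q ?h \<in> Rep_hyp ` e" unfolding Rep_e using d by simp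
  ultimately show "\<exists>z\<in>e. \<exists>\<kappa>>0. Rep_hyp z = \<kappa> *\<^sub>R (v + w)" by force
qed

text \<open>A line through the origin meets the upper sheet at most once.\<close>

lemma scaled_Rep_eq:
  assumes "c *\<^sub>R Rep_hyp z = c' *\<^sub>R Rep_hyp z'" "c \<noteq> 0"
  shows "z = z'"
proof -
  define k where "k = c' / c"
  have z: "Rep_hyp z = k *\<^sub>R Rep_hyp z'"
    using assms by (metis divideR_right k_def scaleR_scaleR divide_inverse_commute)
  then have "k\<^sup>2 = 1" using mink_Rep_self[of z] by (simp add: mink_simps power2_eq_square)
  moreover have "k > 0"
    using fst_Rep_pos[of z] fst_Rep_pos[of z'] by (simp add: z zero_less_mult_iff)
  ultimately have "k = 1" by (simp add: power2_eq_1_iff)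
  with z show ?thesis by (simp add: Rep_hyp_inject)
qed

text \<open>Two common points would put all four normals into one Minkowski plane of signature (1,1),
  in which at most two unit vectors have pairwise negative products.\<close>

lemma perpendiculars_meet_once:
  assumes unit: "mink v v = 1"
    and neg: "mink v v' < 0" "mink v w' < 0" "mink v' w' < -1" "mink v' v' = 1" "mink w' w' = 1"
    and z1: "Rep_hyp z = \<alpha> *\<^sub>R v + \<beta> *\<^sub>R w" "Rep_hyp z = \<alpha>' *\<^sub>R v' + \<beta>' *\<^sub>R w'"
    and z2: "Rep_hyp y = \<gamma> *\<^sub>R v + \<delta> *\<^sub>R w" "Rep_hyp y = \<gamma>' *\<^sub>R v' + \<delta>' *\<^sub>R w'"
  shows "z = y"
proof (rule ccontr)
  assume "z \<noteq> y"
  \<comment> \<open>The determinant of the coordinates of \<open>z\<close> and \<open>y\<close> in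
    \<open>v\<close> and \<open>w\<close>. It is nonzero for distinct points, so Cramer's rule puts
    \<open>v\<close> into the span of both points, hence of \<open>v'\<close> and
    \<open>w'\<close>.\<close>
  let ?D = "\<alpha> * \<delta> - \<gamma> * \<beta>"
  have D1: "?D *\<^sub>R v = \<delta> *\<^sub>R Rep_hyp z - \<beta> *\<^sub>R Rep_hyp y"
    and D2: "?D *\<^sub>R w = \<alpha> *\<^sub>R Rep_hyp y - \<gamma> *\<^sub>R Rep_hyp z"
    by (simp_all add: z1(1) z2(1) algebra_simps)
  have "?D \<noteq> 0"
  proof
    assume "?D = 0"
    then have "\<delta> *\<^sub>R Rep_hyp z = \<beta> *\<^sub>R Rep_hyp y" "\<gamma> *\<^sub>R Rep_hyp z = \<alpha> *\<^sub>R Rep_hyp y"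
      using D1 D2 by simp_all
    then have "\<delta> = 0" "\<gamma> = 0" using scaled_Rep_eq \<open>z \<noteq> y\<close> by blast+
    then have "Rep_hyp y = 0" using z2(1) by simp
    then show False using fst_Rep_pos[of y] by simp
  qed
  define s t where "s = (\<delta> * \<alpha>' - \<beta> * \<gamma>') / ?D" and "t = (\<delta> * \<beta>' - \<beta> * \<delta>') / ?D"
  have "?D *\<^sub>R v = (\<delta> * \<alpha>' - \<beta> * \<gamma>') *\<^sub>R v' + (\<delta> * \<beta>' - \<beta> * \<delta>') *\<^sub>R w'"
    unfolding D1 z1(2) z2(2) by (simp add: algebra_simps)
  also have "\<dots> = ?D *\<^sub>R (s *\<^sub>R v' + t *\<^sub>R w')"
    using \<open>?D \<noteq> 0\<close> by (simp add: s_def t_def scaleR_add_right)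
  finally have v: "v = s *\<^sub>R v' + t *\<^sub>R w'" using \<open>?D \<noteq> 0\<close> by simp
  define x where "x = - mink v' w'"
  have x: "x > 1" using neg(3) by (simp add: x_def)
  have st: "s - t * x < 0" "t - s * x < 0"
    using neg by (simp_all add: v mink_simps mink_commute[of w' v'] x_def)
  \<comment> \<open>The unit norm demands a negative \<open>s\<close> or \<open>t\<close>, whereas
    eliminating between the two inequalities \<open>st\<close> makes both positive.\<close>
  have "s * (s - t * x) + t * (t - s * x) = 1"
    using unit neg by (simp add: v mink_simps mink_commute[of w' v'] x_def algebra_simps)
  then have "s < 0 \<or> t < 0"
    using st by (smt (verit) mult_nonneg_nonpos)
  moreover have "s > 0"
  proof -
    have "t * x < s * x * x" using st(2) x by simp
    with st(1) have "s * (x * x - 1) > 0" by (simp add: algebra_simps)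
    moreover have "x * x - 1 > 0" using mult_strict_mono[OF x x] x by simp
    ultimately show ?thesis by (simp add: zero_less_mult_iff)
  qed
  moreover have "t > 0"
  proof -
    have "s * x < t * x * x" using st(1) x by simp
    with st(2) have "t * (x * x - 1) > 0" by (simp add: algebra_simps)
    moreover have "x * x - 1 > 0" using mult_strict_mono[OF x x] x by simp
    ultimately show ?thesis by (simp add: zero_less_mult_iff)
  qed
  ultimately show False by linarith
qed

text \<open>Disjoint edges attain their minimal distance by compactness. Meeting edges share exactly
  one point, so their intersection is a degenerate arc of length 0.\<close>

lemma transversal_length:
  fixes e e' :: "'a::real_inner hyp set"
  assumes "compact e" "compact e'" "e \<noteq> {}" "e' \<noteq> {}"
    and once: "\<And>z y. z \<in> e \<inter> e' \<Longrightarrow> y \<in> e \<inter> e' \<Longrightarrow> z = y"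
  defines "\<tau> \<equiv> if e \<inter> e' \<noteq> {} then e \<inter> e' else shortest_arc e e'"
  shows "\<exists>p\<in>e. \<exists>q\<in>e'. arc_length \<tau> = dist p q \<and> (\<forall>p'\<in>e. \<forall>q'\<in>e'. dist p q \<le> dist p' q')"
proof (cases "e \<inter> e' = {}")
  case False
  then obtain z where z: "z \<in> e \<inter> e'" by blast
  with once have "\<tau> = {z}" by (auto simp: \<tau>_def)
  then have "arc_length \<tau> = dist z z" using arc_length_eq[OF geodesic_arc_singleton] by blast
  with z show ?thesis by (intro bexI[of _ z]) auto
next
  case True
  have "compact (e \<times> e')" "e \<times> e' \<noteq> {}" using assms by (auto intro: compact_Times)
  moreover have "continuous_on (e \<times> e') (\<lambda>(p, q). dist p q)"
    by (simp add: case_prod_unfold continuous_intros)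
  ultimately obtain u where u: "u \<in> e \<times> e'" "\<forall>z\<in>e \<times> e'. (case u of (p, q) \<Rightarrow> dist p q) \<le> (case z of (p, q) \<Rightarrow> dist p q)"
    using continuous_attains_inf by metis
  obtain p q where "u = (p, q)" by fastforce
  with u have pq: "p \<in> e" "q \<in> e'"
    "\<And>p' q'. p' \<in> e \<Longrightarrow> q' \<in> e' \<Longrightarrow> dist p q \<le> dist p' q'"
    by auto
  obtain p' q' where "p' \<in> e" "q' \<in> e'" "geodesic_arc p' q' (shortest_arc e e')" "dist p' q' = dist p q"
    using shortest_arc_minimal[OF pq] by blast
  then have "arc_length \<tau> = dist p q" using True by (simp add: \<tau>_def arc_length_eq)
  with pq show ?thesis by blast
qed

section \<open>The transversal\<close>

text \<open>The hypothesis is the norm condition of the point \<open>\<alpha> v + \<beta> w\<close>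
  with \<open>x = - mink v w\<close>. The identity isolates the deviation from the midpoint, where
  the sum is smallest.\<close>

lemma coeff_sum_square:
  fixes \<alpha> \<beta> x :: real
  assumes "2 * x * \<alpha> * \<beta> - \<alpha>\<^sup>2 - \<beta>\<^sup>2 = 1"
  shows "(\<alpha> + \<beta>)\<^sup>2 * (x - 1) = 2 + (x + 1) * (\<alpha> - \<beta>)\<^sup>2"
proof -
  have "(\<alpha> + \<beta>)\<^sup>2 * (x - 1) = 2 * (2 * x * \<alpha> * \<beta> - \<alpha>\<^sup>2 - \<beta>\<^sup>2) + (x + 1) * (\<alpha> - \<beta>)\<^sup>2"
    by (simp add: power2_eq_square algebra_simps)
  with assms show ?thesis by simp
qed

lemma coeff_sum_ge:
  fixes \<alpha> \<beta> x :: real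
  assumes "2 * x * \<alpha> * \<beta> - \<alpha>\<^sup>2 - \<beta>\<^sup>2 = 1" "x > 1" "\<alpha> \<ge> 0" "\<beta> \<ge> 0"
  shows "\<alpha> + \<beta> \<ge> sqrt (2 / (x - 1))" "\<alpha> + \<beta> = sqrt (2 / (x - 1)) \<Longrightarrow> \<alpha> = \<beta>"
proof -
  note sq = coeff_sum_square[OF assms(1)]
  have "(x + 1) * (\<alpha> - \<beta>)\<^sup>2 \<ge> 0" using assms(2) by simp
  then have "2 / (x - 1) \<le> (\<alpha> + \<beta>)\<^sup>2" using sq assms(2) by (simp add: pos_divide_le_eq)
  then show "\<alpha> + \<beta> \<ge> sqrt (2 / (x - 1))"
    using assms(3,4) by (simp add: real_le_lsqrt)
  assume "\<alpha> + \<beta> = sqrt (2 / (x - 1))"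
  then have "(\<alpha> + \<beta>)\<^sup>2 = 2 / (x - 1)" using assms(2) by simp
  then have "(\<alpha> + \<beta>)\<^sup>2 * (x - 1) = 2" using assms(2) by (simp add: eq_divide_eq)
  with sq assms(2) show "\<alpha> = \<beta>" by simp
qed

text \<open>Replacing \<open>a\<close>, \<open>b\<close>, \<open>c\<close>, \<open>d\<close> by
  \<open>L\<close> leaves \<open>L\<close> times a product of two coefficient sums, plus nonnegative
  remainders. Equality makes both sums minimal, hence all four coefficients positive, and the
  vanishing remainders then give the value \<open>L\<close>.\<close>

lemma bilinear_coeff_bound:
  fixes \<alpha> \<beta> \<gamma> \<delta> x y a b c d L :: real
  assumes xy: "x > 1" "y > 1" and L: "L > 0" "a \<ge> L" "b \<ge> L" "c \<ge> L" "d \<ge> L"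
    and nonneg: "\<alpha> \<ge> 0" "\<beta> \<ge> 0" "\<gamma> \<ge> 0" "\<delta> \<ge> 0"
    and norm: "2 * x * \<alpha> * \<beta> - \<alpha>\<^sup>2 - \<beta>\<^sup>2 = 1" "2 * y * \<gamma> * \<delta> - \<gamma>\<^sup>2 - \<delta>\<^sup>2 = 1"
  defines "C \<equiv> \<alpha> * \<gamma> * a + \<alpha> * \<delta> * b + \<beta> * \<gamma> * c + \<beta> * \<delta> * d"
  shows "C \<ge> 2 * L / sqrt ((x - 1) * (y - 1))"
    and "C = 2 * L / sqrt ((x - 1) * (y - 1)) \<Longrightarrow> a = L \<and> b = L \<and> c = L \<and> d = L"
proof -
  let ?s = "sqrt (2 / (x - 1))" and ?t = "sqrt (2 / (y - 1))"
  let ?R = "\<alpha> * \<gamma> * (a - L) + \<alpha> * \<delta> * (b - L) + \<beta> * \<gamma> * (c - L) + \<beta> * \<delta> * (d - L)"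
  note ge = coeff_sum_ge(1)[OF norm(1) xy(1) nonneg(1,2)] coeff_sum_ge(1)[OF norm(2) xy(2) nonneg(3,4)]
  note eq = coeff_sum_ge(2)[OF norm(1) xy(1) nonneg(1,2)] coeff_sum_ge(2)[OF norm(2) xy(2) nonneg(3,4)]
  have pos: "?s > 0" "?t > 0" using xy by simp_all
  have "?s * ?t = sqrt (2 * 2 / ((x - 1) * (y - 1)))" by (simp flip: real_sqrt_mult)
  also have "\<dots> = 2 / sqrt ((x - 1) * (y - 1))" by (simp only: real_sqrt_divide real_sqrt_abs2 abs_numeral)
  finally have st: "2 * L / sqrt ((x - 1) * (y - 1)) = L * (?s * ?t)" by simp
  have C: "C = L * ((\<alpha> + \<beta>) * (\<gamma> + \<delta>)) + ?R" by (simp add: C_def algebra_simps)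
  have R: "\<alpha> * \<gamma> * (a - L) \<ge> 0" "\<alpha> * \<delta> * (b - L) \<ge> 0" "\<beta> * \<gamma> * (c - L) \<ge> 0" "\<beta> * \<delta> * (d - L) \<ge> 0"
    using L nonneg by simp_all
  have m: "?s * ?t \<le> ?s * (\<gamma> + \<delta>)" "?s * (\<gamma> + \<delta>) \<le> (\<alpha> + \<beta>) * (\<gamma> + \<delta>)"
    using ge pos nonneg by (simp_all add: mult_left_mono mult_right_mono)
  then have "?s * ?t \<le> (\<alpha> + \<beta>) * (\<gamma> + \<delta>)" by linarith
  then have Lm: "L * (?s * ?t) \<le> L * ((\<alpha> + \<beta>) * (\<gamma> + \<delta>))" using L(1) by simp
  show "C \<ge> 2 * L / sqrt ((x - 1) * (y - 1))" unfolding st using C R Lm by linarith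
  assume "C = 2 * L / sqrt ((x - 1) * (y - 1))"
  with C R Lm st have "L * (?s * ?t) = L * ((\<alpha> + \<beta>) * (\<gamma> + \<delta>))"
    and R0: "\<alpha> * \<gamma> * (a - L) = 0" "\<alpha> * \<delta> * (b - L) = 0" "\<beta> * \<gamma> * (c - L) = 0" "\<beta> * \<delta> * (d - L) = 0"
    by linarith+
  then have "?s * ?t = (\<alpha> + \<beta>) * (\<gamma> + \<delta>)" using L(1) by simp
  with m have "?s * ?t = ?s * (\<gamma> + \<delta>)" "?s * (\<gamma> + \<delta>) = (\<alpha> + \<beta>) * (\<gamma> + \<delta>)" by linarith+
  then have t: "\<gamma> + \<delta> = ?t" and "\<gamma> + \<delta> = 0 \<or> \<alpha> + \<beta> = ?s" using pos by auto
  then have s: "\<alpha> + \<beta> = ?s" using pos by linarith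
  from s t eq pos have "\<alpha> > 0" "\<beta> > 0" "\<gamma> > 0" "\<delta> > 0" by linarith+
  with R0 show "a = L \<and> b = L \<and> c = L \<and> d = L" by simp
qed

lemma mink_combination_norm:
  assumes "mink v v = 1" "mink w w = 1" "Rep_hyp z = \<alpha> *\<^sub>R v + \<beta> *\<^sub>R w"
  shows "2 * (- mink v w) * \<alpha> * \<beta> - \<alpha>\<^sup>2 - \<beta>\<^sup>2 = 1"
  using mink_Rep_self[of z]
  by (simp add: assms mink_simps mink_commute[of w v] power2_eq_square algebra_simps)

text \<open>The sign of each normal is flipped where necessary so that \<open>H m\<close> lies on
  its nonpositive side; pairs of planes then fall under \<open>outward_normals\<close>.\<close>

lemma outward_configuration:
  fixes P H :: "nat \<Rightarrow> hyp3 set"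
  assumes planes: "\<And>m. m \<in> I \<Longrightarrow> plane (P m)"
    and disjoint: "\<And>m n. m \<in> I \<Longrightarrow> n \<in> I \<Longrightarrow> m \<noteq> n \<Longrightarrow> P m \<inter> P n = {}"
    and non_parallel: "\<And>m n. m \<in> I \<Longrightarrow> n \<in> I \<Longrightarrow> m \<noteq> n \<Longrightarrow> \<not> parallel_planes (P m) (P n)"
    and half_spaces: "\<And>m. m \<in> I \<Longrightarrow> half_space (P m) (H m)"
    and sides: "\<And>m n. m \<in> I \<Longrightarrow> n \<in> I \<Longrightarrow> n \<noteq> m \<Longrightarrow> P n \<subseteq> H m"
  obtains v where "\<And>m. m \<in> I \<Longrightarrow> mink (v m) (v m) = 1" "\<And>m. m \<in> I \<Longrightarrow> P m = wall (v m)"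
    "\<And>m n p. m \<in> I \<Longrightarrow> n \<in> I \<Longrightarrow> n \<noteq> m \<Longrightarrow> p \<in> wall (v n) \<Longrightarrow> mink (v m) (Rep_hyp p) \<le> 0"
    "\<And>m n. m \<in> I \<Longrightarrow> n \<in> I \<Longrightarrow> m \<noteq> n \<Longrightarrow> mink (v m) (v n) < -1"
proof -
  have "\<exists>v. mink v v = 1 \<and> P m = wall v \<and> (\<forall>p\<in>H m. mink v (Rep_hyp p) \<le> 0)" if m: "m \<in> I" for m
  proof -
    obtain v where v: "mink v v = 1" "P m = wall v" using plane_eq_wall[OF planes[OF m]] .
    with half_spaces[OF m] have "half_space (wall v) (H m)" by simp
    from half_space_side[OF this] show ?thesis
    proof
      assume "\<forall>p\<in>H m. mink v (Rep_hyp p) \<ge> 0"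
      then show ?thesis using v by (intro exI[of _ "- v"]) (simp add: wall_uminus)
    qed (use v in blast)
  qed
  then obtain v where v: "\<And>m. m \<in> I \<Longrightarrow> mink (v m) (v m) = 1" "\<And>m. m \<in> I \<Longrightarrow> P m = wall (v m)"
    "\<And>m p. m \<in> I \<Longrightarrow> p \<in> H m \<Longrightarrow> mink (v m) (Rep_hyp p) \<le> 0"
    by metis
  have side: "mink (v m) (Rep_hyp p) \<le> 0" if "m \<in> I" "n \<in> I" "n \<noteq> m" "p \<in> wall (v n)" for m n p
    using v(2,3) sides that by blast
  moreover have "mink (v m) (v n) < -1" if mn: "m \<in> I" "n \<in> I" "m \<noteq> n" for m n
  proof (rule outward_normals)
    show "wall (v m) \<inter> wall (v n) = {}"
      "ideal_boundary (wall (v m)) \<inter> ideal_boundary (wall (v n)) = {}"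
      using disjoint[OF mn] non_parallel[OF mn] mn
      by (simp_all add: parallel_planes_def flip: v(2))
  qed (use mn v(1) side in auto)
  ultimately show ?thesis using v(1,2) that by blast
qed

theorem proposition3p5:
  fixes P H :: "nat \<Rightarrow> hyp3 set" and \<Delta> :: "hyp3 set"
    and i j k l :: nat and x y a b c d T L :: real
  assumes planes: "\<And>m. m \<in> {1..4} \<Longrightarrow> plane (P m)"
    and disjoint: "\<And>m n. m \<in> {1..4} \<Longrightarrow> n \<in> {1..4} \<Longrightarrow> m \<noteq> n \<Longrightarrow> P m \<inter> P n = {}"
    and non_parallel:
      "\<And>m n. m \<in> {1..4} \<Longrightarrow> n \<in> {1..4} \<Longrightarrow> m \<noteq> n \<Longrightarrow> \<not> parallel_planes (P m) (P n)"
    and half_spaces: "\<And>m. m \<in> {1..4} \<Longrightarrow> half_space (P m) (H m)"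
    and sides: "\<And>m n. m \<in> {1..4} \<Longrightarrow> n \<in> {1..4} \<Longrightarrow> n \<noteq> m \<Longrightarrow> P n \<subseteq> H m"
    and tetrahedron: "\<Delta> = truncated_tetrahedron P H"
    and ij: "i \<in> {1..4}" "j \<in> {1..4}" "i < j"
    and kl: "k \<in> {1..4} - {i, j}" "l \<in> {1..4} - {i, j}" "k < l"
    and x: "x = cosh (arc_length (internal_edge P i j))"
    and y: "y = cosh (arc_length (internal_edge P k l))"
    and a: "a = cosh (arc_length (internal_edge P i k))"
    and b: "b = cosh (arc_length (internal_edge P i l))"
    and c: "c = cosh (arc_length (internal_edge P j k))"
    and d: "d = cosh (arc_length (internal_edge P j l))"
    and T: "T = arc_length (transversal P i j k l)"
    and L: "L > 1" "a \<ge> L" "b \<ge> L" "c \<ge> L" "d \<ge> L"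
  shows "cosh T \<ge> 2 * L / sqrt ((x - 1) * (y - 1))
    \<and> (cosh T = 2 * L / sqrt ((x - 1) * (y - 1)) \<longleftrightarrow> a = L \<and> b = L \<and> c = L \<and> d = L)"
proof -
  obtain v where unit: "\<And>m. m \<in> {1..4} \<Longrightarrow> mink (v m) (v m) = 1"
    and P: "\<And>m. m \<in> {1..4} \<Longrightarrow> P m = wall (v m)"
    and out: "\<And>m n p. m \<in> {1..4} \<Longrightarrow> n \<in> {1..4} \<Longrightarrow> n \<noteq> m \<Longrightarrow> p \<in> wall (v n) \<Longrightarrow> mink (v m) (Rep_hyp p) \<le> 0"
    and less: "\<And>m n. m \<in> {1..4} \<Longrightarrow> n \<in> {1..4} \<Longrightarrow> m \<noteq> n \<Longrightarrow> mink (v m) (v n) < -1"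
    by (rule outward_configuration[of "{1..4}" P H];
        (rule planes disjoint non_parallel half_spaces sides; assumption)?) blast
  have mem: "i \<in> {1..4}" "j \<in> {1..4}" "k \<in> {1..4}" "l \<in> {1..4}"
    and ne: "i \<noteq> j" "i \<noteq> k" "i \<noteq> l" "j \<noteq> k" "j \<noteq> l" "k \<noteq> l"
    using ij kl by auto
  have edge: "internal_edge P m n = shortest_arc (wall (v m)) (wall (v n))"
    if "m \<in> {1..4}" "n \<in> {1..4}" for m n
    using that by (simp add: internal_edge_def P)
  have walls: "cosh (arc_length (internal_edge P m n)) = - mink (v m) (v n)" "compact (internal_edge P m n)"
      "\<And>z. z \<in> internal_edge P m n \<Longrightarrow> \<exists>\<alpha>\<ge>0. \<exists>\<beta>\<ge>0. Rep_hyp z = \<alpha> *\<^sub>R v m + \<beta> *\<^sub>R v n"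
      "\<exists>z\<in>internal_edge P m n. \<exists>\<kappa>>0. Rep_hyp z = \<kappa> *\<^sub>R (v m + v n)"
    if mn: "m \<in> {1..4}" "n \<in> {1..4}" "m \<noteq> n" for m n
    unfolding edge[OF mn(1,2)]
    by (intro shortest_arc_walls[OF unit[OF mn(1)] unit[OF mn(2)] less[OF mn]];
        use out mn in blast)+
  let ?e = "internal_edge P i j" and ?e' = "internal_edge P k l"
  have prod: "x = - mink (v i) (v j)" "y = - mink (v k) (v l)" "a = - mink (v i) (v k)"
      "b = - mink (v i) (v l)" "c = - mink (v j) (v k)" "d = - mink (v j) (v l)"
    using walls(1) mem ne unfolding x y a b c d by blast+
  note e = walls[OF mem(1,2) ne(1)] and e' = walls[OF mem(3,4) ne(6)]
  have xy: "x > 1" "y > 1"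
    unfolding prod using less[OF mem(1,2) ne(1)] less[OF mem(3,4) ne(6)] by linarith+
  \<comment> \<open>This makes the intersection of meeting edges a single point, as
    \<open>transversal_length\<close> requires.\<close>
  have once: "z = z'" if "z \<in> ?e \<inter> ?e'" "z' \<in> ?e \<inter> ?e'" for z z'
  proof -
    obtain \<alpha> \<beta> where 1: "Rep_hyp z = \<alpha> *\<^sub>R v i + \<beta> *\<^sub>R v j" using e(3) \<open>z \<in> ?e \<inter> ?e'\<close> by blast
    obtain \<alpha>' \<beta>' where 2: "Rep_hyp z = \<alpha>' *\<^sub>R v k + \<beta>' *\<^sub>R v l" using e'(3) \<open>z \<in> ?e \<inter> ?e'\<close> by blast
    obtain \<gamma> \<delta> where 3: "Rep_hyp z' = \<gamma> *\<^sub>R v i + \<delta> *\<^sub>R v j" using e(3) \<open>z' \<in> ?e \<inter> ?e'\<close> by blast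
    obtain \<gamma>' \<delta>' where 4: "Rep_hyp z' = \<gamma>' *\<^sub>R v k + \<delta>' *\<^sub>R v l" using e'(3) \<open>z' \<in> ?e \<inter> ?e'\<close> by blast
    have "mink (v i) (v k) < 0" "mink (v i) (v l) < 0"
      using less[OF mem(1,3) ne(2)] less[OF mem(1,4) ne(3)] by linarith+
    then show ?thesis
      using perpendiculars_meet_once[OF unit[OF mem(1)] _ _ less[OF mem(3,4) ne(6)]
          unit[OF mem(3)] unit[OF mem(4)] 1 2 3 4] by blast
  qed
  have "?e \<noteq> {}" "?e' \<noteq> {}" using e(4) e'(4) by blast+
  from transversal_length[OF e(2) e'(2) this once] obtain p q where p: "p \<in> ?e" and q: "q \<in> ?e'"
    and Tpq: "T = dist p q" and min: "\<And>p' q'. p' \<in> ?e \<Longrightarrow> q' \<in> ?e' \<Longrightarrow> dist p q \<le> dist p' q'"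
    unfolding T transversal_def Let_def by blast
  obtain \<alpha> \<beta> where p_eq: "\<alpha> \<ge> 0" "\<beta> \<ge> 0" "Rep_hyp p = \<alpha> *\<^sub>R v i + \<beta> *\<^sub>R v j"
    using e(3) p by blast
  obtain \<gamma> \<delta> where q_eq: "\<gamma> \<ge> 0" "\<delta> \<ge> 0" "Rep_hyp q = \<gamma> *\<^sub>R v k + \<delta> *\<^sub>R v l"
    using e'(3) q by blast
  have coshT: "cosh T = \<alpha> * \<gamma> * a + \<alpha> * \<delta> * b + \<beta> * \<gamma> * c + \<beta> * \<delta> * d"
    using mink_Rep_Rep[of p q] by (simp add: Tpq p_eq q_eq mink_simps prod algebra_simps)
  have norm_p: "2 * x * \<alpha> * \<beta> - \<alpha>\<^sup>2 - \<beta>\<^sup>2 = 1" and norm_q: "2 * y * \<gamma> * \<delta> - \<gamma>\<^sup>2 - \<delta>\<^sup>2 = 1"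
    unfolding prod using mink_combination_norm[OF unit[OF mem(1)] unit[OF mem(2)] p_eq(3)]
      mink_combination_norm[OF unit[OF mem(3)] unit[OF mem(4)] q_eq(3)] by blast+
  have "L > 0" using L(1) by simp
  note bound = bilinear_coeff_bound[OF xy this L(2-5) p_eq(1,2) q_eq(1,2) norm_p norm_q, folded coshT]
  have "cosh T = 2 * L / sqrt ((x - 1) * (y - 1))" if eq: "a = L" "b = L" "c = L" "d = L"
  proof -
    \<comment> \<open>The midpoints of the two edges: for four equal values \<open>L\<close> their
      distance attains the bound, and minimality of \<open>dist p q\<close> gives the missing
      inequality.\<close>
    obtain z \<kappa> where z: "z \<in> ?e" "\<kappa> > 0" "Rep_hyp z = \<kappa> *\<^sub>R (v i + v j)"
      using e(4) by blast
    obtain z' \<mu> where z': "z' \<in> ?e'" "\<mu> > 0" "Rep_hyp z' = \<mu> *\<^sub>R (v k + v l)"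
      using e'(4) by blast
    \<comment> \<open>The normals are unit vectors with product \<open>- x\<close>, so
      \<open>v i + v j\<close> has square \<open>2 - 2 * x\<close>; likewise for the opposite
      edge.\<close>
    have "\<kappa>\<^sup>2 * (2 * (x - 1)) = 1" "\<mu>\<^sup>2 * (2 * (y - 1)) = 1"
      using mink_Rep_self[of z] mink_Rep_self[of z']
      by (simp_all add: z z' mink_simps unit[OF mem(1)] unit[OF mem(2)] unit[OF mem(3)] unit[OF mem(4)] prod mink_commute[of "v j" "v i"]
          mink_commute[of "v l" "v k"] power2_eq_square algebra_simps)
    then have "(2 * (\<kappa> * \<mu>))\<^sup>2 * ((x - 1) * (y - 1)) = 1"
      by algebra
    then have "(2 * (\<kappa> * \<mu>) * sqrt ((x - 1) * (y - 1)))\<^sup>2 = 1"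
      using xy by (simp add: power_mult_distrib)
    moreover have "2 * (\<kappa> * \<mu>) * sqrt ((x - 1) * (y - 1)) > 0" using z(2) z'(2) xy by simp
    ultimately have "2 * (\<kappa> * \<mu>) * sqrt ((x - 1) * (y - 1)) = 1"
      by (smt (verit) power2_eq_1_iff)
    then have "4 * (\<kappa> * \<mu>) * L = 2 * L / sqrt ((x - 1) * (y - 1))"
      using xy by (simp add: eq_divide_eq)
    moreover have "mink (v i) (v k) = - L" "mink (v i) (v l) = - L" "mink (v j) (v k) = - L" "mink (v j) (v l) = - L"
      using eq prod by linarith+
    then have "cosh (dist z z') = 4 * (\<kappa> * \<mu>) * L"
      using mink_Rep_Rep[of z z'] by (simp add: z z' mink_simps algebra_simps)
    moreover have "cosh T \<le> cosh (dist z z')"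
      using min[OF z(1) z'(1)] by (simp add: Tpq cosh_real_nonneg_le_iff)
    ultimately show ?thesis using bound(1) by linarith
  qed
  with bound show ?thesis by blast
qed

end
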